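(* Let $G$ be a graph of order $n\ge 4$. (i) If $q(G)\ge n$, then $G$ contains a chorded cycle unless $G\cong K_{2,n-2}$ or $G\cong F_{n,c}$ for some $c\in\{0,1,\dots,\lfloor \frac{n-1}{2}\rfloor\}$. (ii) If \[ q(G)\ge \begin{cases} \frac{1}{2}\left(n+2+\sqrt{(n-2)^2+8}\right) & \text{if $n$ is odd}, \\[2mm] \frac{1}{2}\left(n+1+\sqrt{(n-1)^2+8}\right) & \text{if $n$ is even}, \end{cases} \] then $G$ contains a chorded cycle unless $G\cong F_n$.
   Context: All graphs are finite and simple. For a graph $G$, the signless Laplacian matrix is $Q(G)=D(G)+A(G)$, where $D(G)$ is the diagonal matrix of vertex degrees and $A(G)$ is the adjacency matrix; $q(G)$ denotes the largest eigenvalue of $Q(G)$ (the signless Laplacian spectral radius). A chord of a cycle $C$ in $G$ is an edge of $G$ not in $C$ joining two vertices of $C$; a chorded cycle is a cycle having at least one chord. $K_{a,b}$ is the complete bipartite graph with parts of sizes $a$ and $b$. For integers $n\ge 3$ and $0\le c\le \lfloor\frac{n-1}{2}\rfloor$, $F_{n,c}$ is the graph obtained from the star $K_{1,n-1}$ by adding $c$ pairwise nonadjacent (i.e. pairwise vertex-disjoint) edges among the leaves; equivalently $F_{n,c}=K_1\vee((n-1-2c)K_1\cup cK_2)$. In particular $F_{n,0}=K_{1,n-1}$, and $F_n:=F_{n,\lfloor (n-1)/2\rfloor}$.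
   Formalization: Part (i) is proved with one further exception, the disjoint union of K_3 and an isolated vertex (possible only for n = 4), which has q(G) = 4 and no chorded cycle and so refutes part (i) as printed. *)

theory Defs
  imports "Graph_Theory.Graph_Theory" "Jordan_Normal_Form.Spectral_Radius"
begin

text \<open>
  A finite simple graph is a \<^locale>\<open>pair_graph\<close>: a finite, loopfree, symmetric set of arcs, so an
  edge is represented by its two arcs and the degree of a vertex is its out-degree.  The matrices
  below are taken with respect to a list \<open>vs\<close> enumerating the vertices.
\<close>

definition degree_matrix :: "'a pair_pre_digraph \<Rightarrow> 'a list \<Rightarrow> real mat" where
  "degree_matrix G vs = mat (length vs) (length vs)
     (\<lambda>(i, j). if i = j then real (out_degree (with_proj G) (vs ! i)) else 0)"

definition adjacency_matrix :: "'a pair_pre_digraph \<Rightarrow> 'a list \<Rightarrow> real mat" where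
  "adjacency_matrix G vs = mat (length vs) (length vs)
     (\<lambda>(i, j). if (vs ! i, vs ! j) \<in> parcs G then 1 else 0)"

definition signless_laplacian :: "'a pair_pre_digraph \<Rightarrow> 'a list \<Rightarrow> real mat" where
  "signless_laplacian G vs = degree_matrix G vs + adjacency_matrix G vs"

text \<open>
  Another enumeration conjugates the matrix by a permutation matrix, so the choice of the
  enumeration does not affect the spectrum.
\<close>

definition vertex_enum :: "'a pair_pre_digraph \<Rightarrow> 'a list" where
  "vertex_enum G = (SOME vs. distinct vs \<and> set vs = pverts G)"

definition signless_radius :: "'a pair_pre_digraph \<Rightarrow> real" where
  "signless_radius G = Max (spectrum (signless_laplacian G (vertex_enum G)))"

text \<open>
  A cycle is the list of arcs of a closed walk.  The bound on the length excludes the closed walks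
  that traverse a single edge back and forth, which \<^const>\<open>pre_digraph.cycle\<close> admits.
\<close>

definition graph_cycle :: "'a pair_pre_digraph \<Rightarrow> ('a \<times> 'a) list \<Rightarrow> bool" where
  "graph_cycle G p \<longleftrightarrow> pre_digraph.cycle (with_proj G) p \<and> 3 \<le> length p"

definition is_chord :: "'a pair_pre_digraph \<Rightarrow> ('a \<times> 'a) list \<Rightarrow> 'a \<Rightarrow> 'a \<Rightarrow> bool" where
  "is_chord G p x y \<longleftrightarrow> (x, y) \<in> parcs G \<and> x \<in> fst ` set p \<and> y \<in> fst ` set p \<and>
     (x, y) \<notin> set p \<and> (y, x) \<notin> set p"

definition contains_chorded_cycle :: "'a pair_pre_digraph \<Rightarrow> bool" where
  "contains_chorded_cycle G \<longleftrightarrow> (\<exists>p x y. graph_cycle G p \<and> is_chord G p x y)"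

text \<open>
  The star with centre \<open>0\<close> and leaves \<open>1, \<dots>, n - 1\<close>, with the \<open>c\<close> edges \<open>{1, 2}, \<dots>, {2c - 1, 2c}\<close>
  added; meaningful for \<open>2 * c \<le> n - 1\<close>.
\<close>

definition star_plus_matching :: "nat \<Rightarrow> nat \<Rightarrow> nat pair_pre_digraph" where
  "star_plus_matching n c =
     (let r = {0} \<times> {1..<n} \<union> (\<lambda>j. (2 * j - 1, 2 * j)) ` {1..c}
      in \<lparr> pverts = {0..<n}, parcs = r \<union> r\<inverse> \<rparr>)"

definition friendship_graph :: "nat \<Rightarrow> nat pair_pre_digraph" where
  "friendship_graph n = star_plus_matching n ((n - 1) div 2)"

text \<open>
  The disjoint union of \<open>K\<^sub>3\<close> and an isolated vertex.  By the lemmas below it satisfies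
  \<open>q(G) \<ge> n\<close> for \<open>n = 4\<close>, has no chorded cycle, and is isomorphic neither to \<open>K\<^sub>2\<^sub>,\<^sub>2\<close> nor to a
  star with a matching added; hence it has to be listed as a further exception when disconnected
  graphs of order 4 are admitted.
\<close>

definition triangle_plus_vertex :: "nat pair_pre_digraph" where
  "triangle_plus_vertex = \<lparr> pverts = {0, 1, 2, 3},
     parcs = {(u, v). u \<in> {0, 1, 2} \<and> v \<in> {0, 1, 2} \<and> u \<noteq> v} \<rparr>"

lemma triangle_plus_vertex_simps [simp]:
  "pverts triangle_plus_vertex = {0, 1, 2, 3}"
  "(u, v) \<in> parcs triangle_plus_vertex \<longleftrightarrow> u \<in> {0, 1, 2} \<and> v \<in> {0, 1, 2} \<and> u \<noteq> v"
  by (auto simp: triangle_plus_vertex_def)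

lemma pair_graph_triangle_plus_vertex: "pair_graph triangle_plus_vertex"
proof -
  have "parcs triangle_plus_vertex \<subseteq> {0, 1, 2} \<times> {0, 1, 2}"
    by auto
  then have "finite (parcs triangle_plus_vertex)"
    by (rule finite_subset) auto
  then show ?thesis
    by unfold_locales (auto simp: symmetric_def intro!: symI)
qed

lemma card_triangle_plus_vertex: "card (pverts triangle_plus_vertex) = 4"
  by simp

lemma signless_radius_triangle_plus_vertex: "4 \<le> signless_radius triangle_plus_vertex"
proof -
  let ?G = triangle_plus_vertex
  define vs where "vs = vertex_enum ?G"
  have "\<exists>vs. distinct vs \<and> set vs = pverts ?G"
    using finite_distinct_list[of "pverts ?G"] by auto
  then have vs: "distinct vs" "set vs = {0, 1, 2, 3}"
    using someI_ex[of "\<lambda>vs. distinct vs \<and> set vs = pverts ?G"]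
    by (auto simp: vs_def vertex_enum_def)
  have len: "length vs = 4"
    using distinct_card[OF vs(1)] vs(2) by simp
  define Q where "Q = signless_laplacian ?G vs"
  have Q: "Q \<in> carrier_mat 4 4"
    by (simp add: Q_def signless_laplacian_def degree_matrix_def adjacency_matrix_def len)
  define f :: "nat \<Rightarrow> real" where "f u = (if u = 3 then 0 else 1)" for u
  define x where "x = vec 4 (\<lambda>i. f (vs ! i))"
  have deg: "out_degree (with_proj ?G) u = (if u = 3 then 0 else 2)" if u: "u \<in> {0, 1, 2, 3}" for u
  proof -
    have "out_arcs (with_proj ?G) u = {e. e \<in> parcs ?G \<and> fst e = u}"
      unfolding out_arcs_def with_proj_simps by (rule refl)
    also have "\<dots> = Pair u ` {v. (u, v) \<in> parcs ?G}"
      by force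
    finally have "out_degree (with_proj ?G) u = card {v. (u, v) \<in> parcs ?G}"
      unfolding out_degree_def by (simp only: card_image inj_on_def prod.inject simp_thms ball_simps)
    also have "{v. (u, v) \<in> parcs ?G} = {v \<in> {0, 1, 2}. u \<noteq> 3 \<and> v \<noteq> u}"
      using u unfolding triangle_plus_vertex_simps(2) by (intro Collect_cong) auto
    also have "card \<dots> = (if u = 3 then 0 else 2)"
    proof -
      consider "u = 0" | "u = 1" | "u = 2" | "u = 3" using u by blast
      then show ?thesis
      proof cases
        case 1
        then have "{v \<in> {0, 1, 2}. u \<noteq> 3 \<and> v \<noteq> u} = {1, 2}" by auto
        then show ?thesis using 1 by simp
      next
        case 2
        then have "{v \<in> {0, 1, 2}. u \<noteq> 3 \<and> v \<noteq> u} = {0, 2}" by auto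
        then show ?thesis using 2 by simp
      next
        case 3
        then have "{v \<in> {0, 1, 2}. u \<noteq> 3 \<and> v \<noteq> u} = {0, 1}" by auto
        then show ?thesis using 3 by simp
      next
        case 4
        then show ?thesis by simp
      qed
    qed
    finally show ?thesis .
  qed
  have sum_vs: "(\<Sum>j<4. g (vs ! j)) = g 0 + g 1 + g 2 + g 3" for g :: "nat \<Rightarrow> real"
  proof -
    have "(\<Sum>j<4. g (vs ! j)) = sum g (set vs)"
      using sum.reindex_bij_betw[OF bij_betw_nth[OF vs(1) refl refl], of g] len by simp
    then show ?thesis
      by (simp add: vs(2))
  qed
  have row: "(Q *\<^sub>v x) $ i = 4 * x $ i" if i: "i < 4" for i
  proof -
    have mem: "vs ! i \<in> {0, 1, 2, 3}"
      using i nth_mem[of i vs] by (simp only: len vs(2))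
    define g where "g u = ((if vs ! i = u then real (out_degree (with_proj ?G) (vs ! i)) else 0)
        + (if (vs ! i, u) \<in> parcs ?G then 1 else 0)) * f u" for u
    have "(Q *\<^sub>v x) $ i = (\<Sum>j<4. Q $$ (i, j) * f (vs ! j))"
      using i Q by (simp add: x_def scalar_prod_def atLeast0LessThan)
    also have "\<dots> = (\<Sum>j<4. g (vs ! j))"
      using i len vs(1)
      by (intro sum.cong refl)
         (simp add: Q_def signless_laplacian_def degree_matrix_def adjacency_matrix_def
            nth_eq_iff_index_eq g_def)
    also have "\<dots> = 4 * f (vs ! i)"
      using mem unfolding sum_vs[of g] by (auto simp: g_def f_def deg)
    finally show ?thesis
      using i by (simp add: x_def)
  qed
  obtain k where k: "k < 4" "vs ! k = 0"
  proof -
    have "0 \<in> set vs" by (simp add: vs(2))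
    then show ?thesis using that len by (auto simp: in_set_conv_nth)
  qed
  have "x $ k \<noteq> 0\<^sub>v 4 $ k"
    using k by (simp add: x_def f_def)
  then have "x \<noteq> 0\<^sub>v 4"
    by auto
  moreover have "Q *\<^sub>v x = 4 \<cdot>\<^sub>v x"
  proof (rule eq_vecI)
    show "dim_vec (Q *\<^sub>v x) = dim_vec (4 \<cdot>\<^sub>v x)"
      using Q by (simp add: x_def)
    fix i assume "i < dim_vec (4 \<cdot>\<^sub>v x)"
    then have i: "i < 4" by (simp add: x_def)
    then show "(Q *\<^sub>v x) $ i = (4 \<cdot>\<^sub>v x) $ i"
      using row[OF i] by (simp add: x_def)
  qed
  moreover have "x \<in> carrier_vec 4"
    by (simp add: x_def)
  ultimately have "eigenvalue Q 4"
    unfolding eigenvalue_def eigenvector_def using Q by auto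
  then have "4 \<in> spectrum Q"
    by (simp add: spectrum_def)
  then show ?thesis
    unfolding signless_radius_def Q_def[symmetric] vs_def[symmetric]
    using card_finite_spectrum(1)[OF Q] by (intro Max_ge) auto
qed

lemma triangle_plus_vertex_no_chorded_cycle: "\<not> contains_chorded_cycle triangle_plus_vertex"
proof
  let ?G = triangle_plus_vertex
  interpret pair_graph ?G by (rule pair_graph_triangle_plus_vertex)
  assume "contains_chorded_cycle ?G"
  then obtain p x y where p: "graph_cycle ?G p" and ch: "is_chord ?G p x y"
    unfolding contains_chorded_cycle_def by blast
  from p obtain u where u: "pcas u p u" "distinct (tl (pawalk_verts u p))"
      "set p \<subseteq> parcs ?G" "3 \<le> length p"
    by (auto simp: graph_cycle_def cycle_def awalk_def)
  have tl_verts: "tl (pawalk_verts w p) = map snd p" if "pcas w p v" for w v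
    using that
  proof (induction p arbitrary: w)
    case (Cons a p)
    then show ?case by (cases p) auto
  qed simp
  have "snd ` set p \<subseteq> {0, 1, 2}"
    using u(3) by auto
  then have "card (set (map snd p)) \<le> card {0, 1, 2 :: nat}"
    by (intro card_mono) auto
  moreover have "distinct (map snd p)"
    using u(2) tl_verts[OF u(1)] by simp
  ultimately have "length p = 3"
    using distinct_card[of "map snd p"] u(4) by simp
  then obtain a b c where "p = [a, b, c]"
    by (auto simp: numeral_3_eq_3 length_Suc_conv)
  then obtain v w where p: "p = [(u, v), (v, w), (w, u)]"
    using u(1) by (cases a; cases b; cases c) simp
  have x: "x = u \<or> x = v \<or> x = w" and y: "y = u \<or> y = v \<or> y = w" and xy: "x \<noteq> y"
    and not_in: "(x, y) \<notin> set p" "(y, x) \<notin> set p"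
    using ch unfolding is_chord_def by (simp_all add: p)
  have "(x, y) \<in> set p \<or> (y, x) \<in> set p"
    using x y xy unfolding p by (elim disjE) simp_all
  with not_in show False by blast
qed

lemma triangle_plus_vertex_not_complete_bipartite:
  "\<not> complete_bipartite_digraph 2 2 (with_proj triangle_plus_vertex)"
proof
  assume "complete_bipartite_digraph 2 2 (with_proj triangle_plus_vertex)"
  then obtain U V where UV: "{0, 1, 2, 3} = U \<union> V" "card U = 2" "card V = 2"
      "parcs triangle_plus_vertex = U \<times> V \<union> V \<times> U"
    by (auto simp: complete_bipartite_digraph_pair_def)
  have "U \<noteq> {}" "V \<noteq> {}"
    using UV(2,3) by auto
  moreover have "3 \<in> U \<or> 3 \<in> V"
    using UV(1) by blast
  ultimately obtain v where "(3, v) \<in> parcs triangle_plus_vertex"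
    unfolding UV(4) by blast
  then show False by simp
qed

lemma triangle_plus_vertex_not_star_plus_matching:
  "\<not> digraph_iso (with_proj triangle_plus_vertex) (with_proj (star_plus_matching 4 c))"
proof
  let ?G = triangle_plus_vertex and ?F = "star_plus_matching 4 c"
  assume "digraph_iso (with_proj ?G) (with_proj ?F)"
  then obtain h where h: "pre_digraph.digraph_isomorphism (with_proj ?G) h"
      and F: "with_proj ?F = app_iso h (with_proj ?G)"
    unfolding digraph_iso_def by blast
  have verts: "pverts ?F = iso_verts h ` {0, 1, 2, 3}"
    using arg_cong[OF F, of verts] by simp
  have arcs: "parcs ?F = iso_arcs h ` parcs ?G" and tail: "fst = iso_tail h"
    using arg_cong[OF F, of arcs] arg_cong[OF F, of tail] by simp_all
  have inj: "inj_on (iso_verts h) {0, 1, 2, 3}"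
    and tail_eq: "\<And>a. a \<in> parcs ?G \<Longrightarrow> iso_verts h (fst a) = iso_tail h (iso_arcs h a)"
    using h by (auto simp: pre_digraph.digraph_isomorphism_def)
  have "iso_verts h 3 \<in> {0..<4}"
    using verts by (auto simp: star_plus_matching_def Let_def)
  then have "(iso_verts h 3, if iso_verts h 3 = 0 then 1 else 0) \<in> parcs ?F"
    by (auto simp: star_plus_matching_def Let_def)
  then obtain w where "(iso_verts h 3, w) \<in> parcs ?F" ..
  then obtain a where a: "a \<in> parcs ?G" "iso_arcs h a = (iso_verts h 3, w)"
    using arcs by auto
  then have "iso_verts h (fst a) = iso_verts h 3"
    using tail_eq[OF a(1)] tail by (metis fst_conv)
  moreover have "fst a \<in> {0, 1, 2}"
    using a(1) by (cases a) auto
  ultimately show False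
    using inj_onD[OF inj, of "fst a" 3] by auto
qed

end

theory Submission
  imports Defs
begin

text \<open>
  For a positive weight \<open>y\<close> on the vertices, \<open>q(G)\<close> is at most the largest of the quotients
  \<open>(d(u) y(u) + \<Sum>\<^sub>v\<^sub>~\<^sub>u y(v)) / y(u)\<close>, and if it is equal to that maximum then the maximum is attained
  on a nonempty set of vertices closed under adjacency.  With \<open>y = d\<close> the quotient is
  \<open>d(u)\<close> plus the average degree of the neighbours of \<open>u\<close>.  Without chorded cycles the neighbourhood of \<open>u\<close>
  induces a matching, and an outside vertex joined to a matched neighbour has no other neighbour
  there; counting edges, the quotient is at most \<open>n\<close> when no vertex is dominating, except when
  \<open>u\<close> misses a single vertex and all its neighbours are matched, where explicit other weights
  work.  The equality case yields \<open>K\<^sub>2\<^sub>,\<^sub>n\<^sub>-\<^sub>2\<close>.  A graph with a dominating vertex is some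
  \<open>F\<^sub>n\<^sub>,\<^sub>c\<close>, and weights taken from the eigenvector of \<open>F\<^sub>n\<close> show that only the largest \<open>c\<close> reaches
  the bound of part (ii).
\<close>

section \<open>Weighted bounds for the signless Laplacian radius\<close>

text \<open>\<open>signless_radius\<close> is a \<open>Max\<close> over real eigenvalues, so it
  needs one to exist. A complex eigenvalue \<open>k\<close> always exists; symmetry makes it real,
  and then it is a root of the characteristic polynomial over the reals.\<close>

lemma spectrum_real_symmetric_nonempty:
  fixes A :: "real mat"
  assumes A: "A \<in> carrier_mat n n" and "0 < n"
    and sym: "\<And>i j. i < n \<Longrightarrow> j < n \<Longrightarrow> A $$ (i, j) = A $$ (j, i)"
  shows "spectrum A \<noteq> {}"
proof -
  define B where "B = map_mat complex_of_real A"
  have B: "B \<in> carrier_mat n n"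
    using A by (simp add: B_def)
  obtain k where "eigenvalue B k"
    using spectrum_non_empty[OF B \<open>0 < n\<close>] by (auto simp: spectrum_def)
  then obtain v where v: "v \<in> carrier_vec n" "v \<noteq> 0\<^sub>v n" "B *\<^sub>v v = k \<cdot>\<^sub>v v"
    using B by (auto simp: eigenvalue_def eigenvector_def)
  have row: "k * v $ i = (\<Sum>j<n. of_real (A $$ (i, j)) * v $ j)" if i: "i < n" for i
  proof -
    have "k * v $ i = (B *\<^sub>v v) $ i"
      using v i by simp
    also have "\<dots> = (\<Sum>j<n. of_real (A $$ (i, j)) * v $ j)"
      using A B v(1) i by (simp add: B_def scalar_prod_def atLeast0LessThan)
    finally show ?thesis .
  qed
  define N where "N = (\<Sum>i<n. (cmod (v $ i))\<^sup>2)"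
  \<comment> \<open>The Hermitian form of \<open>A\<close> at \<open>v\<close>. It equals
    \<open>k\<close> times the squared norm, and conjugation only swaps its two summation
    indices.\<close>
  define s where "s = (\<Sum>i<n. \<Sum>j<n. of_real (A $$ (i, j)) * cnj (v $ i) * v $ j)"
  have "k * of_real N = (\<Sum>i<n. cnj (v $ i) * (k * v $ i))"
    unfolding N_def of_real_sum sum_distrib_left
    by (intro sum.cong refl) (simp only: complex_norm_square, simp add: mult_ac)
  also have "\<dots> = s"
    unfolding s_def by (intro sum.cong refl) (simp add: row sum_distrib_left mult_ac)
  finally have ks: "k * of_real N = s" .
  have "cnj s = (\<Sum>i<n. \<Sum>j<n. of_real (A $$ (i, j)) * cnj (v $ j) * v $ i)"
    unfolding s_def by (simp add: mult_ac)
  also have "\<dots> = (\<Sum>j<n. \<Sum>i<n. of_real (A $$ (i, j)) * cnj (v $ j) * v $ i)"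
    by (rule sum.swap)
  also have "\<dots> = s"
    unfolding s_def by (intro sum.cong refl) (simp add: sym)
  finally have "cnj (k * of_real N) = k * of_real N"
    by (simp only: ks)
  then have "cnj k * of_real N = k * of_real N"
    by simp
  moreover have "N \<noteq> 0"
  proof -
    obtain i where "i < n" "v $ i \<noteq> 0"
      using v(1,2) by (metis eq_vecI carrier_vecD index_zero_vec)
    then have "0 < (cmod (v $ i))\<^sup>2" "(cmod (v $ i))\<^sup>2 \<le> N"
      unfolding N_def by (auto intro!: member_le_sum)
    then show ?thesis by linarith
  qed
  ultimately have "cnj k = k"
    by simp
  then obtain r where r: "k = of_real r"
    by (metis Reals_cnj_iff Reals_cases)
  have "poly (char_poly B) k = 0"
    using \<open>eigenvalue B k\<close> eigenvalue_root_char_poly[OF B] by simp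
  then have "poly (char_poly A) r = 0"
    unfolding B_def of_real_hom.char_poly_hom[OF A] r by simp
  then have "eigenvalue A r"
    using eigenvalue_root_char_poly[OF A] by simp
  then show ?thesis
    by (auto simp: spectrum_def)
qed


section \<open>Neighbour sets and the eigenvalue equation on vertices\<close>

definition neighbors :: "'a pair_pre_digraph \<Rightarrow> 'a \<Rightarrow> 'a set" where
  "neighbors G u = {v. (u, v) \<in> parcs G}"

lemma in_neighbors: "v \<in> neighbors G u \<longleftrightarrow> (u, v) \<in> parcs G"
  by (simp add: neighbors_def)

lemma vertex_enum:
  assumes "finite (pverts G)"
  shows "distinct (vertex_enum G)" "set (vertex_enum G) = pverts G"
proof -
  have "\<exists>vs. distinct vs \<and> set vs = pverts G"
    using finite_distinct_list[OF assms] by auto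
  then have "distinct (vertex_enum G) \<and> set (vertex_enum G) = pverts G"
    unfolding vertex_enum_def by (rule someI_ex)
  then show "distinct (vertex_enum G)" "set (vertex_enum G) = pverts G"
    by auto
qed

context pair_graph
begin

abbreviation "V \<equiv> pverts G"
abbreviation "N \<equiv> neighbors G"

lemma neighbors_sym: "v \<in> N u \<longleftrightarrow> u \<in> N v"
  using pair_sym_arcs by (auto simp: neighbors_def symmetric_def elim: symE)

lemma neighbors_irrefl [simp]: "u \<notin> N u"
  using pair_no_loops by (force simp: neighbors_def)

lemma neighbors_subset: "N u \<subseteq> V"
  using arc_snd_in_verts by (force simp: neighbors_def)

lemma neighbors_in_verts: "v \<in> N u \<Longrightarrow> u \<in> V" "v \<in> N u \<Longrightarrow> v \<in> V"
  using neighbors_subset[of u] neighbors_subset[of v] neighbors_sym by auto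

lemma finite_neighbors [simp]: "finite (N u)"
  using neighbors_subset pair_finite_verts by (rule finite_subset)

lemma out_degree_eq_card_neighbors: "out_degree (with_proj G) u = card (N u)"
proof -
  have "out_arcs (with_proj G) u = Pair u ` N u"
    by (force simp: out_arcs_def neighbors_def)
  then show ?thesis
    by (simp add: out_degree_def card_image inj_on_def)
qed

text \<open>Pulls an eigenvector back along the chosen enumeration, so that matrices and index
  arithmetic do not occur in later arguments.\<close>

lemma signless_radius_eigenfunction:
  assumes "V \<noteq> {}"
  obtains x :: "'a \<Rightarrow> real" where "\<exists>u\<in>V. x u \<noteq> 0"
    and "\<And>u. u \<in> V \<Longrightarrow> signless_radius G * x u = card (N u) * x u + (\<Sum>v\<in>N u. x v)"
proof -
  define vs where "vs = vertex_enum G"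
  define n where "n = length vs"
  define Q where "Q = signless_laplacian G vs"
  note vs = vertex_enum[OF pair_finite_verts, folded vs_def]
  have n: "0 < n"
    using assms vs by (auto simp: n_def)
  have Q: "Q \<in> carrier_mat n n"
    by (simp add: Q_def signless_laplacian_def degree_matrix_def adjacency_matrix_def n_def)
  have Q_index: "Q $$ (i, j) = (if vs ! i = vs ! j then card (N (vs ! i)) else 0)
      + (if vs ! j \<in> N (vs ! i) then 1 else 0)" if "i < n" "j < n" for i j
    using that vs(1)
    by (simp add: Q_def signless_laplacian_def degree_matrix_def adjacency_matrix_def n_def
        nth_eq_iff_index_eq in_neighbors out_degree_eq_card_neighbors)
  have "Q $$ (i, j) = Q $$ (j, i)" if "i < n" "j < n" for i j
    using that by (simp add: Q_index neighbors_sym)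
  then have "spectrum Q \<noteq> {}"
    using spectrum_real_symmetric_nonempty[OF Q n] by blast
  then have "signless_radius G \<in> spectrum Q"
    unfolding signless_radius_def vs_def[symmetric] Q_def[symmetric]
    by (intro Max_in card_finite_spectrum(1)[OF Q])
  then obtain z where z: "z \<in> carrier_vec n" "z \<noteq> 0\<^sub>v n" "Q *\<^sub>v z = signless_radius G \<cdot>\<^sub>v z"
    using Q by (auto simp: spectrum_def eigenvalue_def eigenvector_def)
  define x where "x u = z $ the_inv_into {..<n} ((!) vs) u" for u
  have bij: "bij_betw ((!) vs) {..<n} V"
    using bij_betw_nth[OF vs(1) refl vs(2)[symmetric]] by (simp add: n_def)
  have x: "x (vs ! i) = z $ i" if "i < n" for i
    using that bij by (simp add: x_def the_inv_into_f_f bij_betw_def)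
  have V_nth: "\<exists>i<n. u = vs ! i" if "u \<in> V" for u
    using that bij by (auto simp: bij_betw_def)
  show ?thesis
  proof
    obtain i where "i < n" "z $ i \<noteq> 0"
      using z(1,2) by (metis eq_vecI carrier_vecD index_zero_vec)
    moreover from this have "vs ! i \<in> V"
      by (metis n_def nth_mem vs(2))
    ultimately show "\<exists>u\<in>V. x u \<noteq> 0"
      using x by metis
  next
    fix u assume "u \<in> V"
    then obtain i where i: "i < n" "u = vs ! i"
      using V_nth by blast
    define g where "g v = ((if u = v then real (card (N u)) else 0) + (if v \<in> N u then 1 else 0)) * x v" for v
    have "signless_radius G * x u = (Q *\<^sub>v z) $ i"
      using z i x by simp
    also have "\<dots> = (\<Sum>j<n. Q $$ (i, j) * z $ j)"
      using Q z(1) i by (simp add: scalar_prod_def atLeast0LessThan)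
    also have "\<dots> = (\<Sum>j<n. g (vs ! j))"
      using i by (intro sum.cong refl) (simp add: g_def Q_index x)
    also have "\<dots> = sum g V"
      by (rule sum.reindex_bij_betw[OF bij])
    also have "\<dots> = (\<Sum>v\<in>V. if u = v then card (N u) * x v else 0) + (\<Sum>v\<in>V. if v \<in> N u then x v else 0)"
      unfolding g_def by (simp add: distrib_right if_distrib[of "\<lambda>c. c * _"] sum.distrib cong: if_cong)
    also have "\<dots> = card (N u) * x u + (\<Sum>v\<in>N u. x v)"
      using \<open>u \<in> V\<close> pair_finite_verts neighbors_subset[of u]
      by (simp add: sum.If_cases Int_absorb1)
    finally show "signless_radius G * x u = card (N u) * x u + (\<Sum>v\<in>N u. x v)" .
  qed
qed

text \<open>
  A vertex maximising \<open>\<bar>x u\<bar> / y u\<close> for an eigenfunction \<open>x\<close> attains equality, and equality there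
  forces all its neighbours to be maximisers too.
\<close>

lemma signless_radius_weighted_rows:
  fixes y :: "'a \<Rightarrow> real"
  assumes "V \<noteq> {}" and y: "\<And>u. u \<in> V \<Longrightarrow> 0 < y u"
    and rows: "\<And>u. u \<in> V \<Longrightarrow> card (N u) * y u + (\<Sum>v\<in>N u. y v) \<le> r * y u"
    and r: "r \<le> signless_radius G"
  obtains S where "S \<noteq> {}" "S \<subseteq> V" "\<And>u. u \<in> S \<Longrightarrow> N u \<subseteq> S"
    "\<And>u. u \<in> S \<Longrightarrow> card (N u) * y u + (\<Sum>v\<in>N u. y v) = r * y u"
    "signless_radius G = r"
proof -
  obtain x :: "'a \<Rightarrow> real" where nz: "\<exists>u\<in>V. x u \<noteq> 0"
    and x: "\<And>u. u \<in> V \<Longrightarrow> signless_radius G * x u = card (N u) * x u + (\<Sum>v\<in>N u. x v)"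
    using signless_radius_eigenfunction[OF assms(1)] by blast
  define M where "M = Max ((\<lambda>u. \<bar>x u\<bar> / y u) ` V)"
  have fin: "finite ((\<lambda>u. \<bar>x u\<bar> / y u) ` V)"
    using pair_finite_verts by simp
  have le: "\<bar>x u\<bar> \<le> M * y u" if "u \<in> V" for u
  proof -
    have "\<bar>x u\<bar> / y u \<le> M"
      unfolding M_def using fin that by (intro Max_ge) auto
    then show ?thesis
      using y[OF that] by (simp add: divide_le_eq)
  qed
  have "M \<in> (\<lambda>u. \<bar>x u\<bar> / y u) ` V"
    unfolding M_def using fin assms(1) by (intro Max_in) auto
  then obtain w where w: "w \<in> V" "M = \<bar>x w\<bar> / y w"
    by blast
  have M: "0 < M"
  proof -
    obtain u where "u \<in> V" "x u \<noteq> 0"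
      using nz by blast
    then have "0 < M * y u" "0 < y u"
      using le[of u] y[of u] by auto
    then show ?thesis
      by (simp add: zero_less_mult_iff)
  qed
  define S where "S = {u \<in> V. \<bar>x u\<bar> = M * y u}"
  have main: "card (N u) * y u + (\<Sum>v\<in>N u. y v) = r * y u \<and> signless_radius G = r \<and> N u \<subseteq> S"
    if "u \<in> S" for u
  proof -
    have u: "u \<in> V" "\<bar>x u\<bar> = M * y u"
      using that by (auto simp: S_def)
    have pos: "0 < M * y u"
      using M y u by simp
    have nbr_le: "\<bar>x v\<bar> \<le> M * y v" if "v \<in> N u" for v
      using le that neighbors_subset by blast
    let ?q = "signless_radius G" and ?Y = "card (N u) * y u + (\<Sum>v\<in>N u. y v)"
    have A': "r * (M * y u) \<le> ?q * (M * y u)"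
      using r pos by (intro mult_right_mono) simp_all
    have "?q * (M * y u) \<le> \<bar>?q * x u\<bar>"
      using pos by (simp add: abs_mult u(2) mult_right_mono)
    also have "\<dots> = \<bar>card (N u) * x u + (\<Sum>v\<in>N u. x v)\<bar>"
      using x u by simp
    also have "\<dots> \<le> card (N u) * \<bar>x u\<bar> + \<bar>\<Sum>v\<in>N u. x v\<bar>"
      by (rule order_trans[OF abs_triangle_ineq]) (simp add: abs_mult)
    also have "\<dots> \<le> card (N u) * \<bar>x u\<bar> + (\<Sum>v\<in>N u. \<bar>x v\<bar>)"
      by (simp add: sum_abs)
    finally have A: "?q * (M * y u) \<le> card (N u) * \<bar>x u\<bar> + (\<Sum>v\<in>N u. \<bar>x v\<bar>)" .
    have B: "(\<Sum>v\<in>N u. \<bar>x v\<bar>) \<le> (\<Sum>v\<in>N u. M * y v)"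
      using nbr_le by (intro sum_mono)
    have C: "card (N u) * \<bar>x u\<bar> + (\<Sum>v\<in>N u. M * y v) = M * ?Y"
      by (simp add: u(2) distrib_left mult_ac flip: sum_distrib_left)
    have D: "M * ?Y \<le> M * (r * y u)"
      using rows[OF u(1)] M by simp
    have E: "M * (r * y u) = r * (M * y u)" by simp
    \<comment> \<open>The chain \<open>A'\<close>, \<open>A\<close>, \<open>B\<close>,
      \<open>C\<close>, \<open>D\<close>, \<open>E\<close> starts and ends at
      \<open>r * (M * y u)\<close>, so each of its inequalities is an equality.\<close>
    have "M * ?Y = M * (r * y u)" "r * (M * y u) = ?q * (M * y u)"
      "(\<Sum>v\<in>N u. \<bar>x v\<bar>) = (\<Sum>v\<in>N u. M * y v)"
      using A A' B C D E by linarith+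
    then have eqs: "?Y = r * y u" "r = ?q" "(\<Sum>v\<in>N u. \<bar>x v\<bar>) = (\<Sum>v\<in>N u. M * y v)"
      using M y[OF u(1)] by auto
    have "(\<Sum>v\<in>N u. M * y v - \<bar>x v\<bar>) = 0"
      using eqs(3) by (simp add: sum_subtractf)
    then have "\<forall>v\<in>N u. M * y v - \<bar>x v\<bar> = 0"
      using nbr_le by (subst (asm) sum_nonneg_eq_0_iff) auto
    then have "N u \<subseteq> S"
      using neighbors_subset by (force simp: S_def)
    with eqs show ?thesis by simp
  qed
  have "w \<in> S"
    using w y[of w] by (simp add: S_def)
  then show ?thesis
    using main by (intro that[of S]) (auto simp: S_def)
qed

lemma signless_radius_less_weighted_rows:
  fixes y :: "'a \<Rightarrow> real"
  assumes "V \<noteq> {}" and y: "\<And>u. u \<in> V \<Longrightarrow> 0 < y u"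
    and rows: "\<And>u. u \<in> V \<Longrightarrow> card (N u) * y u + (\<Sum>v\<in>N u. y v) < r * y u"
  shows "signless_radius G < r"
proof (rule ccontr)
  assume "\<not> signless_radius G < r"
  then have le: "r \<le> signless_radius G" by simp
  show False
  proof (rule signless_radius_weighted_rows[OF assms(1) y less_imp_le[OF rows] le])
    fix S assume S: "S \<noteq> {}" "S \<subseteq> V"
      and S_rows: "\<And>u. u \<in> S \<Longrightarrow> card (N u) * y u + (\<Sum>v\<in>N u. y v) = r * y u"
    obtain u where u: "u \<in> S" using S(1) by blast
    then show False
      using S(2) S_rows[OF u] rows[of u] by auto
  qed
qed

end

section \<open>Isomorphisms of pair graphs and enumeration of pairs\<close>

text \<open>\<open>digraph_iso\<close> asks for separate maps on vertices, arcs, heads and tails; in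
  a pair graph the vertex map \<open>h\<close> induces all of them.\<close>

lemma digraph_iso_pairI:
  assumes "pair_wf_digraph G" "inj_on h (pverts G)" "pverts H = h ` pverts G"
    and "parcs H = (\<lambda>(u, v). (h u, h v)) ` parcs G"
  shows "digraph_iso (with_proj G) (with_proj H)"
proof -
  interpret pair_wf_digraph G by fact
  let ?f = "\<lparr> iso_verts = h, iso_arcs = (\<lambda>(u, v). (h u, h v)), iso_head = snd, iso_tail = fst \<rparr>"
  have "inj_on (\<lambda>(u, v). (h u, h v)) (parcs G)"
    using assms(2) by (auto simp: inj_on_def dest: in_arcsD1 in_arcsD2)
  then have "digraph_isomorphism ?f"
    using assms(2) wf_digraph by (auto simp: digraph_isomorphism_def)
  moreover have "with_proj H = app_iso ?f (with_proj G)"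
    by (simp add: app_iso_def with_proj_def assms(3,4))
  ultimately show ?thesis
    unfolding digraph_iso_def by blast
qed

text \<open>Removing one orbit \<open>{x, p x}\<close> at a time gives an induction. Partners land
  on the indices \<open>2 * j - 1\<close> and \<open>2 * j\<close> to fit the matching edges of
  \<open>star_plus_matching\<close>.\<close>

lemma involution_enumeration:
  assumes "finite A" "\<And>x. x \<in> A \<Longrightarrow> p x \<in> A \<and> p x \<noteq> x \<and> p (p x) = x"
  obtains c :: nat and g :: "nat \<Rightarrow> 'a"
  where "bij_betw g {1..2 * c} A" "\<And>j. j \<in> {1..c} \<Longrightarrow> p (g (2 * j - 1)) = g (2 * j)"
proof -
  have "\<exists>c (g :: nat \<Rightarrow> 'a). bij_betw g {1..2 * c} A \<and> (\<forall>j\<in>{1..c}. p (g (2 * j - 1)) = g (2 * j))"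
    using assms
  proof (induction A rule: finite_psubset_induct)
    case (psubset A)
    show ?case
    proof (cases "A = {}")
      case True
      then show ?thesis
        by (intro exI[of _ "0 :: nat"]) (simp add: bij_betw_def)
    next
      case False
      then obtain x where x: "x \<in> A" by blast
      let ?B = "A - {x, p x}"
      have px: "p x \<in> A" "p x \<noteq> x" "p (p x) = x"
        using psubset.prems[OF x] by auto
      have "p y \<in> ?B \<and> p y \<noteq> y \<and> p (p y) = y" if "y \<in> ?B" for y
        using psubset.prems[of y] that px by (metis DiffD1 DiffD2 DiffI insert_iff singletonD)
      moreover have "?B \<subset> A"
        using x by blast
      ultimately obtain c and g :: "nat \<Rightarrow> 'a"
        where g: "bij_betw g {1..2 * c} ?B" "\<forall>j\<in>{1..c}. p (g (2 * j - 1)) = g (2 * j)"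
        using psubset.IH[of ?B] by blast
      define h where "h = g(2 * c + 1 := x, 2 * c + 2 := p x)"
      have "bij_betw h {1..2 * c} ?B"
        using g(1) by (subst bij_betw_cong[of _ _ g]) (auto simp: h_def)
      moreover have "bij_betw h {2 * c + 1, 2 * c + 2} {x, p x}"
        using px(2) by (auto simp: h_def bij_betw_def inj_on_def)
      ultimately have "bij_betw h ({1..2 * c} \<union> {2 * c + 1, 2 * c + 2}) (?B \<union> {x, p x})"
        by (rule bij_betw_combine) auto
      moreover have "{1..2 * c} \<union> {2 * c + 1, 2 * c + 2} = {1..2 * Suc c}"
        by auto
      moreover have "?B \<union> {x, p x} = A"
        using x px by blast
      ultimately have "bij_betw h {1..2 * Suc c} A"
        by simp
      moreover have "p (h (2 * j - 1)) = h (2 * j)" if "j \<in> {1..Suc c}" for j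
      proof (cases "j = Suc c")
        case True
        then show ?thesis by (simp add: h_def)
      next
        case False
        then have "j \<in> {1..c}" using that by auto
        then show ?thesis using g(2) by (auto simp: h_def)
      qed
      ultimately show ?thesis by blast
    qed
  qed
  then show ?thesis using that by blast
qed

lemma pair_wf_digraph_star_plus_matching:
  assumes "2 * c \<le> n - 1"
  shows "pair_wf_digraph (star_plus_matching n c)"
  using assms by unfold_locales (auto simp: star_plus_matching_def Let_def)

section \<open>Neighbourhoods in graphs without chorded cycles\<close>

text \<open>The vertex list of a walk without its start is the list of its arc heads, so for an
  explicit list of arcs every condition on a cycle can be checked by simplification.\<close>

lemma (in pair_graph) contains_chorded_cycleI:
  assumes "pcas u p u" "set p \<subseteq> parcs G" "3 \<le> length p" "distinct (map snd p)" "is_chord G p x y"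
  shows "contains_chorded_cycle G"
proof -
  have "tl (pawalk_verts w p) = map snd p" if "pcas w p v" for w v
    using that
  proof (induction p arbitrary: w)
    case (Cons a p)
    then show ?case by (cases p) auto
  qed simp
  moreover have "u \<in> V"
    using assms(1-3) by (cases p) (auto intro: arc_fst_in_verts)
  ultimately have "graph_cycle G p"
    using assms(1-4) by (auto simp: graph_cycle_def cycle_def awalk_def)
  then show ?thesis
    using assms(5) by (auto simp: contains_chorded_cycle_def)
qed

lemma sum_card_nbrs_swap:
  assumes "finite A" "finite B" "\<And>a b. R a b \<longleftrightarrow> R' b a"
  shows "(\<Sum>a\<in>A. card {b \<in> B. R a b}) = (\<Sum>b\<in>B. card {a \<in> A. R' b a})"
  using sum_multicount_gen[OF assms(1,2), of R "\<lambda>b. card {a \<in> A. R' b a}"] assms(3) by simp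

locale chorded_cycle_free = pair_graph +
  assumes no_chorded_cycle: "\<not> contains_chorded_cycle G"
begin

text \<open>The cycle is a-b-c-d with chord ac. Adjacent vertices differ, so only
  \<open>b \<noteq> d\<close> has to be supplied.\<close>

lemma no_chorded_4_cycle:
  assumes "b \<in> N a" "c \<in> N b" "d \<in> N c" "a \<in> N d" "c \<in> N a" "b \<noteq> d"
  shows False
proof -
  have "distinct [a, b, c, d]"
    using assms by auto
  then have "contains_chorded_cycle G"
    using assms by (intro contains_chorded_cycleI[of a "[(a, b), (b, c), (c, d), (d, a)]" a c])
      (auto simp: in_neighbors is_chord_def)
  then show False using no_chorded_cycle by blast
qed

lemma no_chorded_5_cycle:
  assumes "b \<in> N a" "c \<in> N b" "d \<in> N c" "e \<in> N d" "a \<in> N e" "c \<in> N a"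
    and "distinct [a, b, c, d, e]"
  shows False
proof -
  have "contains_chorded_cycle G"
    using assms by (intro contains_chorded_cycleI[of a "[(a, b), (b, c), (c, d), (d, e), (e, a)]" a c])
      (auto simp: in_neighbors is_chord_def)
  then show False using no_chorded_cycle by blast
qed

text \<open>The chord joins opposite vertices; this is what excludes a complete bipartite subgraph
  with three vertices on each side.\<close>

lemma no_chorded_6_cycle:
  assumes "b \<in> N a" "c \<in> N b" "d \<in> N c" "e \<in> N d" "f \<in> N e" "a \<in> N f" "d \<in> N a"
    and "distinct [a, b, c, d, e, f]"
  shows False
proof -
  have "contains_chorded_cycle G"
    using assms by (intro contains_chorded_cycleI[of a "[(a, b), (b, c), (c, d), (d, e), (e, f), (f, a)]" a d])
      (auto simp: in_neighbors is_chord_def)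
  then show False using no_chorded_cycle by blast
qed

text \<open>Two common neighbours b, c of u and a would give the cycle u-b-a-c with chord
  ua.\<close>

lemma partner_unique:
  assumes "a \<in> N u" "b \<in> N u" "c \<in> N u" "b \<in> N a" "c \<in> N a"
  shows "b = c"
  using no_chorded_4_cycle[of b u a c] assms neighbors_sym by blast

text \<open>
  Since \<open>G\<close> has no 4-cycle with a chord, \<open>N u\<close> induces a matching together with isolated vertices;
  \<open>M u\<close> is the set of matched vertices.
\<close>

definition M :: "'a \<Rightarrow> 'a set" where
  "M u = {a \<in> N u. N a \<inter> N u \<noteq> {}}"

text \<open>For a vertex \<open>u\<close>, the condition \<open>W u = {}\<close> says that
  \<open>u\<close> is dominating; the final proof splits on it.\<close>

definition W :: "'a \<Rightarrow> 'a set" where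
  "W u = V - N u - {u}"

lemma M_subset: "M u \<subseteq> N u"
  by (auto simp: M_def)

lemma finite_M [simp]: "finite (M u)" and finite_W [simp]: "finite (W u)"
  using finite_subset[OF M_subset] pair_finite_verts by (auto simp: W_def)

lemma partner:
  assumes "a \<in> M u"
  obtains b where "b \<in> M u" "b \<in> N u" "b \<in> N a" "b \<noteq> a" "N a \<inter> N u = {b}"
proof -
  obtain b where b: "b \<in> N a" "b \<in> N u"
    using assms by (auto simp: M_def)
  moreover have "a \<in> N u"
    using assms M_subset by blast
  moreover from calculation have "N a \<inter> N u = {b}"
    using partner_unique by blast
  moreover have "b \<in> M u"
    using b \<open>a \<in> N u\<close> neighbors_sym by (auto simp: M_def)
  ultimately show ?thesis
    using that neighbors_irrefl by metis
qed

text \<open>Let b be the partner of a, and c a second neighbour of w in \<open>N u\<close>. If c =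
  b, the cycle a-u-b-w has chord ab; otherwise u-b-a-w-c has chord ua.\<close>

lemma outside_nbr_of_matched:
  assumes "a \<in> M u" "w \<in> W u" "a \<in> N w"
  shows "N w \<inter> N u = {a}"
proof -
  obtain b where b: "b \<in> N u" "b \<in> N a" "b \<noteq> a"
    using assms(1) partner by metis
  have a: "a \<in> N u"
    using assms(1) M_subset by blast
  have w: "w \<noteq> u" "w \<noteq> b" "w \<notin> N u"
    using assms(2) b by (auto simp: W_def)
  have "c = a" if c: "c \<in> N w" "c \<in> N u" for c
  proof (rule ccontr)
    assume "c \<noteq> a"
    show False
    proof (cases "c = b")
      case True
      then show False
        using no_chorded_4_cycle[of u a b w] a b c w assms(3) neighbors_sym by blast
    next
      case False
      moreover have "u \<noteq> a" "u \<noteq> b" "u \<noteq> c" "w \<noteq> a" "w \<noteq> c"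
        using a b c assms(3) by auto
      ultimately show False
        using no_chorded_5_cycle[of b u a w c] a b c w assms(3) \<open>c \<noteq> a\<close> neighbors_sym[of _ u]
          neighbors_sym[of a b] neighbors_sym[of a w] by auto
    qed
  qed
  then show ?thesis
    using a assms(3) by blast
qed

section \<open>Edge counts around a vertex\<close>

text \<open>Either \<open>w\<close> sees only unmatched neighbours of \<open>u\<close>, or it sees a
  matched one and then nothing else in \<open>N u\<close>; the \<open>1\<close> in the maximum
  covers the second case.\<close>

lemma card_outside_nbrs_le:
  assumes "w \<in> W u"
  shows "card (N w \<inter> N u) \<le> max 1 (card (N u) - card (M u))"
proof (cases "N w \<inter> M u = {}")
  case True
  then have "N w \<inter> N u \<subseteq> N u - M u"
    by blast
  then have "card (N w \<inter> N u) \<le> card (N u - M u)"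
    by (intro card_mono) auto
  then show ?thesis
    using M_subset by (simp add: card_Diff_subset)
next
  case False
  then obtain a where "a \<in> M u" "a \<in> N w"
    by blast
  then show ?thesis
    using outside_nbr_of_matched[OF _ assms] by simp
qed

lemma card_verts_split:
  assumes "u \<in> V"
  shows "card V = 1 + card (N u) + card (W u)"
proof -
  have "V = insert u (N u \<union> W u)"
    using assms neighbors_subset by (auto simp: W_def)
  moreover have "u \<notin> N u \<union> W u"
    by (auto simp: W_def)
  moreover have "card (N u \<union> W u) = card (N u) + card (W u)"
    by (intro card_Un_disjoint) (auto simp: W_def)
  ultimately show ?thesis
    by (metis Suc_eq_plus1 add.assoc add.commute card_insert_disjoint finite_UnI finite_W finite_neighbors)
qed

lemma nbr_split:
  assumes "a \<in> N u"
  shows "N a = insert u (N a \<inter> N u \<union> N a \<inter> W u)"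
  using assms neighbors_sym neighbors_in_verts by (auto simp: W_def)

lemma card_nbr_split:
  assumes "a \<in> N u"
  shows "card (N a) = 1 + (if a \<in> M u then 1 else 0) + card (N a \<inter> W u)"
proof -
  have "card (N a) = Suc (card (N a \<inter> N u \<union> N a \<inter> W u))"
    by (subst nbr_split[OF assms], rule card_insert_disjoint) (auto simp: W_def)
  also have "card (N a \<inter> N u \<union> N a \<inter> W u) = card (N a \<inter> N u) + card (N a \<inter> W u)"
    by (intro card_Un_disjoint) (auto simp: W_def)
  also have "card (N a \<inter> N u) = (if a \<in> M u then 1 else 0)"
  proof (cases "a \<in> M u")
    case True
    then show ?thesis
      using partner by (metis is_singletonI is_singleton_altdef)
  next
    case False
    then show ?thesis
      using assms by (simp add: M_def)
  qed
  finally show ?thesis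
    by simp
qed

text \<open>This is the neighbour sum in the row of \<open>u\<close> for degree weights. Edges
  leaving \<open>N u\<close> are counted from their ends in \<open>W u\<close>, where
  \<open>card_outside_nbrs_le\<close> applies.\<close>

lemma sum_card_nbrs:
  "(\<Sum>a\<in>N u. card (N a)) = card (N u) + card (M u) + (\<Sum>w\<in>W u. card (N w \<inter> N u))"
proof -
  have "(\<Sum>a\<in>N u. card (N a)) = (\<Sum>a\<in>N u. 1 + (if a \<in> M u then 1 else 0) + card (N a \<inter> W u))"
    by (intro sum.cong refl) (simp only: card_nbr_split)
  also have "\<dots> = card (N u) + (\<Sum>a\<in>N u. if a \<in> M u then 1 else 0) + (\<Sum>a\<in>N u. card (N a \<inter> W u))"
    by (simp only: sum.distrib) simp
  also have "(\<Sum>a\<in>N u. if a \<in> M u then 1 else 0) = card (M u)"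
    using M_subset[of u] by (simp add: sum.If_cases Int_absorb1)
  also have "(\<Sum>a\<in>N u. card (N a \<inter> W u)) = (\<Sum>w\<in>W u. card (N w \<inter> N u))"
    using sum_card_nbrs_swap[of "N u" "W u" "\<lambda>a w. w \<in> N a" "\<lambda>w a. a \<in> N w"] neighbors_sym
    by (simp add: Int_def conj_commute)
  finally show ?thesis .
qed

lemma card_M_ge_2:
  assumes "M u \<noteq> {}"
  shows "2 \<le> card (M u)"
proof -
  obtain a b where ab: "a \<in> M u" "b \<in> M u" "b \<noteq> a"
    using assms partner by (metis ex_in_conv)
  then have "card {a, b} \<le> card (M u)"
    by (intro card_mono) auto
  then show ?thesis
    using ab by simp
qed

lemma card_M_le: "card (M u) \<le> card (N u)"
  using M_subset by (intro card_mono) auto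

lemma sum_outside_le:
  "(\<Sum>w\<in>W u. card (N w \<inter> N u)) \<le> card (W u) * max 1 (card (N u) - card (M u))"
  using sum_bounded_above[of "W u" "\<lambda>w. card (N w \<inter> N u)" "max 1 (card (N u) - card (M u))"]
    card_outside_nbrs_le by simp

text \<open>Since the order is 1 + d + k, with d, m, k the sizes of \<open>N u\<close>,
  \<open>M u\<close>, \<open>W u\<close>, this is the bound by the order for the degree-weighted row
  of \<open>u\<close>. For m < d it follows from s <= k(d - m) and m <= km; for m = d > 0 from s <=
  k and d + k <= dk, which needs k >= 2. This is why \<open>exc\<close> rules out k = 1.\<close>

lemma outside_row_le:
  assumes "W u \<noteq> {}" and exc: "\<not> (N u \<noteq> {} \<and> M u = N u \<and> card (W u) = 1)"
  shows "card (M u) + (\<Sum>w\<in>W u. card (N w \<inter> N u)) \<le> card (N u) * card (W u)"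
proof -
  let ?d = "card (N u)" and ?m = "card (M u)" and ?k = "card (W u)"
  let ?s = "\<Sum>w\<in>W u. card (N w \<inter> N u)"
  have k: "1 \<le> ?k"
    using assms(1) by (simp add: Suc_le_eq card_gt_0_iff)
  have s: "?s \<le> ?k * max 1 (?d - ?m)"
    by (rule sum_outside_le)
  consider "N u = {}" | "N u \<noteq> {}" "M u = N u" | "?m < ?d"
    using M_subset[of u] psubset_card_mono[of "N u" "M u"] by auto
  then show ?thesis
  proof cases
    case 1
    then show ?thesis
      by (simp add: M_def)
  next
    case 2
    then have "2 \<le> ?d"
      using card_M_ge_2[of u] by simp
    \<comment> \<open>After shifting d and k by 2, the inequality d + k <= dk compares polynomials
      with nonnegative coefficients.\<close>
    then obtain d' where d': "?d = d' + 2"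
      by (metis add.commute le_Suc_ex)
    have "?k \<noteq> 1"
      using exc 2 by blast
    then obtain k' where k': "?k = k' + 2"
      using k by (metis add.commute le_Suc_ex le_antisym not_less_eq_eq numeral_2_eq_2 One_nat_def)
    have "?s \<le> ?k"
      using s 2 by simp
    then show ?thesis
      using 2 d' k' by (simp add: algebra_simps)
  next
    case 3
    then have "max 1 (?d - ?m) = ?d - ?m"
      by simp
    then have "?s \<le> ?k * (?d - ?m)"
      using s by (simp only:)
    moreover have "?m \<le> ?k * ?m"
      using k by simp
    ultimately have "?m + ?s \<le> ?k * ?m + ?k * (?d - ?m)"
      by (rule add_mono[rotated])
    also have "\<dots> = ?k * ?d"
      using 3 by (simp flip: distrib_left)
    finally show ?thesis
      by (simp add: mult.commute)
  qed
qed

section \<open>Degree weights and their equality case\<close>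

text \<open>Equality holds on a set \<open>S\<close> closed under adjacency, so m + s = dk at each
  of its vertices. Every configuration with a matched neighbour is refuted; once \<open>M u\<close>
  is empty, s = dk forces each outside vertex to see all of \<open>N u\<close>.\<close>

lemma signless_radius_ge_order:
  assumes card_V: "card V = n" and "4 \<le> n" and W: "\<And>u. u \<in> V \<Longrightarrow> W u \<noteq> {}"
    and exc: "\<And>u. u \<in> V \<Longrightarrow> \<not> (N u \<noteq> {} \<and> M u = N u \<and> card (W u) = 1)"
    and q: "real n \<le> signless_radius G"
  obtains u where "u \<in> V" "N u \<noteq> {}" "M u = {}" "\<And>w. w \<in> W u \<Longrightarrow> N u \<subseteq> N w"
    "signless_radius G = n"
proof -
  \<comment> \<open>The maximum with \<open>1\<close> only affects isolated vertices, whose degree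
    would not be a positive weight.\<close>
  define y :: "'a \<Rightarrow> real" where "y u = max 1 (real (card (N u)))" for u
  have y_pos: "0 < y u" for u
    by (simp add: y_def)
  have y_eq: "y u = card (N u)" if "N u \<noteq> {}" for u
  proof -
    have "0 < card (N u)"
      using that by (simp add: card_gt_0_iff)
    then show ?thesis
      by (simp add: y_def)
  qed
  have y_nbr: "y v = card (N v)" if "v \<in> N u" for u v
    using that neighbors_sym[of v u] by (intro y_eq) blast
  let ?row = "\<lambda>u. card (N u) * y u + (\<Sum>v\<in>N u. y v)"
  let ?s = "\<lambda>u. \<Sum>w\<in>W u. card (N w \<inter> N u)"
  have row: "?row u = real (card (N u) * card (N u) + (card (N u) + card (M u) + ?s u))" for u
  proof -
    have "(\<Sum>v\<in>N u. y v) = real (\<Sum>v\<in>N u. card (N v))"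
      unfolding of_nat_sum by (intro sum.cong refl y_nbr)
    moreover have "card (N u) * y u = card (N u) * card (N u)"
      by (cases "N u = {}") (simp_all add: y_eq)
    ultimately show ?thesis
      unfolding sum_card_nbrs by simp
  qed
  have n_eq: "n = 1 + card (N u) + card (W u)" if "u \<in> V" for u
    using card_verts_split[OF that] card_V by simp
  have row_le: "?row u \<le> n * y u" if u: "u \<in> V" for u
  proof (cases "N u = {}")
    case True
    then show ?thesis by (simp add: y_def)
  next
    case False
    then have y: "y u = card (N u)"
      by (rule y_eq)
    have "card (N u) * card (N u) + (card (N u) + card (M u) + ?s u) \<le> n * card (N u)"
      using outside_row_le[OF W[OF u] exc[OF u]] n_eq[OF u] by (simp add: algebra_simps)
    then have "real (card (N u) * card (N u) + (card (N u) + card (M u) + ?s u)) \<le> real (n * card (N u))"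
      by (simp only: of_nat_le_iff)
    then show ?thesis
      unfolding row by (simp only: y of_nat_mult)
  qed
  have "V \<noteq> {}"
    using card_V \<open>4 \<le> n\<close> by auto
  then obtain S where S: "S \<noteq> {}" "S \<subseteq> V" "\<And>u. u \<in> S \<Longrightarrow> N u \<subseteq> S"
      and S_row: "\<And>u. u \<in> S \<Longrightarrow> ?row u = n * y u" and q_eq: "signless_radius G = n"
    using signless_radius_weighted_rows[OF _ y_pos row_le q] by blast
  have S_card: "card (M u) + ?s u = card (N u) * card (W u)" "N u \<noteq> {}" if u: "u \<in> S" for u
  proof -
    have "N u \<noteq> {}"
    proof
      assume "N u = {}"
      then show False
        using S_row[OF u] \<open>4 \<le> n\<close> by (simp add: y_def)
    qed
    then have "y u = card (N u)"
      by (rule y_eq)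
    then have "real (card (N u) * card (N u) + (card (N u) + card (M u) + ?s u)) = real (n * card (N u))"
      using S_row[OF u] unfolding row by simp
    then have "card (N u) * card (N u) + (card (N u) + card (M u) + ?s u) = n * card (N u)"
      by (simp only: of_nat_eq_iff)
    moreover have "n = 1 + card (N u) + card (W u)"
      using n_eq u S(2) by blast
    ultimately show "card (M u) + ?s u = card (N u) * card (W u)"
      by (simp add: algebra_simps)
    show "N u \<noteq> {}" by fact
  qed
  \<comment> \<open>The row equation of a pendant vertex reads 1 + deg a = n, which would make its
    neighbour dominating.\<close>
  have no_pendant: False if "v \<in> S" "N v = {a}" for v a
  proof -
    have "a \<in> N v"
      using that(2) by simp
    moreover from this have "a \<in> V"
      by (rule neighbors_in_verts)
    moreover from calculation have "1 + real (card (N a)) = n"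
      using S_row[OF that(1)] that(2) y_nbr[of a v] by (simp add: y_def)
    ultimately have "card (W a) = 0"
      using n_eq[of a] by simp
    then show False
      using W[OF \<open>a \<in> V\<close>] by simp
  qed
  obtain u where u: "u \<in> S" using S(1) by blast
  then have uV: "u \<in> V" using S(2) by blast
  let ?d = "card (N u)" and ?m = "card (M u)" and ?k = "card (W u)"
  have k: "1 \<le> ?k"
    using W[OF uV] by (simp add: Suc_le_eq card_gt_0_iff)
  have eq: "?m + ?s u = ?d * ?k"
    by (rule S_card[OF u])
  have s: "?s u \<le> ?k * max 1 (?d - ?m)"
    by (rule sum_outside_le)
  have "M u = {}"
  proof (rule ccontr)
    assume "M u \<noteq> {}"
    then have m: "2 \<le> ?m"
      by (rule card_M_ge_2)
    show False
    proof (cases "M u = N u")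
      case False
      then have md: "?m < ?d"
        using M_subset[of u] by (intro psubset_card_mono) auto
      then have "max 1 (?d - ?m) = ?d - ?m"
        by simp
      then have s': "?s u \<le> ?k * (?d - ?m)"
        using s by (simp only:)
      have "?k * ?m + ?k * (?d - ?m) = ?k * ?d"
        using md by (simp flip: distrib_left)
      \<comment> \<open>Subtracting the bound s <= k(d - m) from m + s = dk leaves km <= m, hence k
        = 1.\<close>
      then have "?k * ?m \<le> ?m"
        using s' eq mult.commute[of ?d ?k] by linarith
      then have k1: "?k = 1"
        using k m by simp
      then obtain w where w: "W u = {w}"
        using card_1_singletonE by blast
      have deg_eq: "card (N w \<inter> N u) = ?d - ?m"
        using eq k1 w by simp
      show False
      proof (cases "N w \<inter> M u = {}")
        case True
        obtain a where a: "a \<in> M u"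
          using \<open>M u \<noteq> {}\<close> by blast
        then obtain b where b: "b \<in> M u" "b \<in> N u" "b \<in> N a" "b \<noteq> a" "N a \<inter> N u = {b}"
          by (rule partner)
        have "a \<in> N u" using a M_subset by blast
        have nbrs: "card (N v) = 2" if "v \<in> M u" for v
        proof -
          have "w \<notin> N v"
            using True that neighbors_sym[of w v] by blast
          then have "N v \<inter> W u = {}"
            using w by simp
          moreover have "v \<in> N u"
            using that M_subset by blast
          ultimately show ?thesis
            using card_nbr_split[of v u] that by simp
        qed
        have "w \<notin> N a"
          using True a neighbors_sym[of w a] by blast
        then have "N a = {u, b}"
          using nbr_split[OF \<open>a \<in> N u\<close>] b w by auto
        moreover have "u \<noteq> b" using b by auto
        moreover have "y u = ?d"
          using y_nbr[of u a] \<open>a \<in> N u\<close> neighbors_sym[of u a] by blast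
        moreover have "y b = 2" "y a = 2"
          using nbrs a b by (simp_all add: y_def)
        \<comment> \<open>With n = d + 2 this row equation gives d = 2, against 2 <= m < d.\<close>
        ultimately have "2 * 2 + (real ?d + 2) = n * 2"
          using S_row[of a] S(3)[OF u] \<open>a \<in> N u\<close> by auto
        then have "2 * 2 + (?d + 2) = n * 2"
          by linarith
        then show False
          using n_eq[OF uV] k1 md m by simp
      next
        case False
        then obtain a where a: "a \<in> M u" "a \<in> N w"
          by blast
        then have Nw: "N w \<inter> N u = {a}"
          using outside_nbr_of_matched[of a u w] w by blast
        obtain b where b: "b \<in> N u" "b \<notin> M u"
          using md M_subset by (metis card_mono finite_M leD subsetI)
        then have "b \<notin> N w"
          using Nw a by auto
        then have "N b = {u}"
          using nbr_split[OF b(1)] b w neighbors_sym[of w b] by (auto simp: M_def)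
        then show False
          using no_pendant[of b u] b S(3)[OF u] by blast
      qed
    next
      case True
      then have "?k \<noteq> 1"
        using exc[OF uV] S_card(2)[OF u] by blast
      then obtain k' where k': "?k = k' + 2"
        using k by (metis add.commute le_Suc_ex le_antisym not_less_eq_eq numeral_2_eq_2 One_nat_def)
      obtain d' where d': "?d = d' + 2"
        using m True by (metis add.commute le_Suc_ex)
      have "?s u \<le> ?k"
        using s True by simp
      \<comment> \<open>That is dk <= d + k with d, k >= 2, so d = k = 2 and n = 5: a triangle on
        \<open>u\<close>, with two outside vertices that each see one of the other two
        corners.\<close>
      then have "(d' + 2) * (k' + 2) \<le> (d' + 2) + (k' + 2)"
        using eq True d' k' by simp
      then have "d' = 0" "k' = 0"
        by (simp_all add: algebra_simps)
      then have d2: "?d = 2" "?k = 2" "?s u = 2"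
        using d' k' eq True by simp_all
      have n5: "n = 5"
        using n_eq[OF uV] d2 by simp
      obtain w1 w2 where w: "W u = {w1, w2}" "w1 \<noteq> w2"
        using d2(2) by (meson card_2_iff)
      have "card (N w1 \<inter> N u) \<le> 1" "card (N w2 \<inter> N u) \<le> 1"
        using card_outside_nbrs_le[of w1 u] card_outside_nbrs_le[of w2 u] True w by simp_all
      then have "card (N w1 \<inter> N u) = 1" "card (N w2 \<inter> N u) = 1"
        using d2(3) w by simp_all
      then obtain a c where a: "N w1 \<inter> N u = {a}" and c: "N w2 \<inter> N u = {c}"
        by (meson card_1_singletonE)
      have wu: "w1 \<notin> N u" "w2 \<notin> N u" "w1 \<noteq> u" "w2 \<noteq> u"
        using w by (auto simp: W_def)
      have "a \<in> M u"
        using a True by blast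
      then obtain b where b: "b \<in> N u" "b \<in> N a" "b \<noteq> a"
        using partner by metis
      have aN: "a \<in> N u" "a \<in> N w1" using a by auto
      have "card {a, b} = ?d"
        using b(3) d2(1) by simp
      then have Nu: "N u = {a, b}"
        using b aN card_subset_eq[of "N u" "{a, b}"] by simp
      have "a \<in> V" using aN neighbors_in_verts by blast
      have V_eq: "V = {u, a, b, w1, w2}"
        using w(1) Nu uV neighbors_subset[of u] by (auto simp: W_def)
      show False
      \<comment> \<open>If both outside vertices attach to \<open>a\<close>, then \<open>a\<close>
        is dominating. Otherwise an edge between them would close the cycle a-u-b-w2-w1 with chord
        ab, so \<open>w1\<close> is pendant.\<close>
      proof (cases "c = a")
        case True
        then have "{u, b, w1, w2} \<subseteq> N a"
          using True aN b(2) c neighbors_sym[of u a] neighbors_sym[of w1 a] neighbors_sym[of w2 a] by auto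
        then have "W a = {}"
          using V_eq by (auto simp: W_def)
        then show False
          using W[OF \<open>a \<in> V\<close>] by blast
      next
        case False
        then have "c = b"
          using c Nu by auto
        then have "b \<in> N w2"
          using c by auto
        have "w2 \<notin> N w1"
        proof
          assume "w2 \<in> N w1"
          moreover have "distinct [u, a, b, w2, w1]"
            using wu w(2) aN b by auto
          ultimately show False
            using no_chorded_5_cycle[of u a b w2 w1] aN b \<open>b \<in> N w2\<close>
              neighbors_sym[of a u] neighbors_sym[of b w2] neighbors_sym[of w1 w2]
            by auto
        qed
        have "v \<in> N u" if v: "v \<in> N w1" for v
        proof -
          have "v \<in> V" "v \<noteq> w1" "v \<noteq> w2" "v \<noteq> u"
            using v \<open>w2 \<notin> N w1\<close> neighbors_in_verts(2)[OF v] neighbors_sym[of v w1] wu(1) by auto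
          then show ?thesis
            using V_eq Nu by simp
        qed
        then have "N w1 = {a}"
          using a by blast
        moreover have "w1 \<in> S"
          using S(3)[OF u] S(3)[of a] aN neighbors_sym[of w1 a] by blast
        ultimately show False
          using no_pendant by blast
      qed
    qed
  qed
  moreover have "N u \<subseteq> N w" if "w \<in> W u" for w
  proof -
    have "?s u = (\<Sum>w\<in>W u. ?d)"
      using eq \<open>M u = {}\<close> by simp
    then have "(\<Sum>w\<in>W u. ?d - card (N w \<inter> N u)) = 0"
      by (subst sum_subtractf_nat) (auto intro: card_mono)
    then have "?d \<le> card (N w \<inter> N u)"
      using that by simp
    then have "N w \<inter> N u = N u"
      by (intro card_seteq) auto
    then show ?thesis by blast
  qed
  ultimately show ?thesis
    using that uV S_card(2)[OF u] q_eq by blast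
qed

text \<open>\<open>N u\<close> is independent, and has two vertices because a single one would be
  dominating. An edge ww' in \<open>insert u (W u)\<close> would then be a chord of w-a-w'-b with a,
  b in \<open>N u\<close>. So G is complete bipartite, and \<open>no_chorded_6_cycle\<close> leaves
  one part of size 2.\<close>

lemma complete_bipartite_2_if_join:
  assumes u: "u \<in> V" "M u = {}" and join: "\<And>w. w \<in> W u \<Longrightarrow> N u \<subseteq> N w"
    and "W u \<noteq> {}" "N u \<noteq> {}" and W: "\<And>a. a \<in> N u \<Longrightarrow> W a \<noteq> {}"
  shows "complete_bipartite_digraph 2 (card V - 2) (with_proj G)"
proof -
  have indep: "v \<notin> N a" if "a \<in> N u" "v \<in> N u" for a v
    using that u(2) by (auto simp: M_def)
  have V_eq: "V = N u \<union> insert u (W u)" and disj: "N u \<inter> insert u (W u) = {}"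
    using u(1) neighbors_subset by (auto simp: W_def)
  have join': "a \<in> N w" if "a \<in> N u" "w \<in> insert u (W u)" for a w
    using that join by blast
  have two: "\<exists>b\<in>N u. b \<noteq> a" if "a \<in> N u" for a
  proof (rule ccontr)
    assume "\<not> (\<exists>b\<in>N u. b \<noteq> a)"
    then have "V - {a} \<subseteq> insert u (W u)"
      using V_eq by blast
    moreover have "insert u (W u) \<subseteq> N a"
    proof
      fix w assume "w \<in> insert u (W u)"
      then show "w \<in> N a"
        using join'[OF that] neighbors_sym[of a w] by blast
    qed
    ultimately have "W a = {}"
      by (auto simp: W_def)
    then show False
      using W[OF that] by blast
  qed
  have indep': "w' \<notin> N w" if w: "w \<in> insert u (W u)" "w' \<in> insert u (W u)" for w w'
  proof
    assume ww: "w' \<in> N w"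
    obtain a where a: "a \<in> N u"
      using \<open>N u \<noteq> {}\<close> by blast
    obtain b where b: "b \<in> N u" "b \<noteq> a"
      using two[OF a] by blast
    have adj: "a \<in> N w" "a \<in> N w'" "b \<in> N w" "b \<in> N w'"
      using join' a b w by blast+
    then show False
      using no_chorded_4_cycle[of a w w' b] adj ww b neighbors_sym[of w' a] neighbors_sym[of w b]
      by blast
  qed
  have arcs: "parcs G = N u \<times> insert u (W u) \<union> insert u (W u) \<times> N u"
  proof (rule Set.set_eqI)
    fix e :: "'a \<times> 'a"
    obtain v w where e: "e = (v, w)" by fastforce
    show "e \<in> parcs G \<longleftrightarrow> e \<in> N u \<times> insert u (W u) \<union> insert u (W u) \<times> N u"
    proof
      assume "e \<in> parcs G"
      then have vw: "w \<in> N v" "v \<in> V" "w \<in> V"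
        using e neighbors_in_verts[of w v] by (simp_all add: in_neighbors)
      then show "e \<in> N u \<times> insert u (W u) \<union> insert u (W u) \<times> N u"
        using e V_eq indep indep' by blast
    next
      assume "e \<in> N u \<times> insert u (W u) \<union> insert u (W u) \<times> N u"
      then have "w \<in> N v"
        using e join' neighbors_sym[of v w] by blast
      then show "e \<in> parcs G"
        using e by (simp add: in_neighbors)
    qed
  qed
  have card_V: "card V = card (N u) + card (insert u (W u))"
    using V_eq disj by (metis card_Un_disjoint finite.insertI finite_W finite_neighbors)
  have "card (N u) = 2 \<or> card (insert u (W u)) = 2"
  proof (rule ccontr)
    assume no: "\<not> ?thesis"
    obtain a where a: "a \<in> N u"
      using \<open>N u \<noteq> {}\<close> by blast
    obtain b where b: "b \<in> N u" "b \<noteq> a"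
      using two[OF a] by blast
    have "N u \<noteq> {a, b}"
      using no b by auto
    then obtain c where c: "c \<in> N u" "c \<noteq> a" "c \<noteq> b"
      using a b by blast
    obtain w where w: "w \<in> W u"
      using \<open>W u \<noteq> {}\<close> by blast
    have "w \<noteq> u"
      using w by (auto simp: W_def)
    then have "insert u (W u) \<noteq> {u, w}"
      using no by auto
    then obtain w' where w': "w' \<in> W u" "w' \<noteq> u" "w' \<noteq> w"
      using w by blast
    have "a \<in> N w" "b \<in> N w" "b \<in> N w'" "c \<in> N w'" "c \<in> N w" "a \<in> N w'"
      using join w w' a b c by blast+
    moreover have "w \<notin> N u" "w' \<notin> N u"
      using w w' by (auto simp: W_def)
    then have "distinct [u, a, w, b, w', c]"
      using a b c w' \<open>w \<noteq> u\<close> by auto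
    ultimately show False
      using no_chorded_6_cycle[of a u w b w' c] a b c neighbors_sym[of w a] neighbors_sym[of w' b]
        neighbors_sym[of u c] by blast
  qed
  then show ?thesis
  proof
    assume "card (N u) = 2"
    then show ?thesis
      unfolding complete_bipartite_digraph_pair_def
      using pair_finite_verts V_eq disj arcs card_V
      by (intro conjI exI[of _ "N u"] exI[of _ "insert u (W u)"]) simp_all
  next
    assume "card (insert u (W u)) = 2"
    then show ?thesis
      unfolding complete_bipartite_digraph_pair_def
      using pair_finite_verts V_eq disj arcs card_V
      by (intro conjI exI[of _ "insert u (W u)"] exI[of _ "N u"]) (simp_all add: Un_commute Int_commute)
  qed
qed

text \<open>
  If \<open>w\<close> has a neighbour, the degree-weighted row of \<open>u\<close> exceeds the order; the weights below are
  perturbed from an approximate eigenvector.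
\<close>

lemma signless_radius_lt_order:
  assumes n: "card V = n" "6 \<le> n" and u: "u \<in> V" "M u = N u" "W u = {w}"
  shows "signless_radius G < n"
proof -
  have d: "card (N u) = n - 2"
    using card_verts_split[OF u(1)] n u(3) by simp
  have w: "w \<noteq> u" "w \<notin> N u" "u \<notin> N w"
    using u(3) neighbors_sym[of u w] by (auto simp: W_def)
  have V_eq: "V = insert u (insert w (N u))"
    using u neighbors_subset[of u] by (auto simp: W_def)
  have "w \<in> V" using V_eq by blast
  have Nw: "N w \<subseteq> N u"
  proof
    fix v assume v: "v \<in> N w"
    then have "v \<noteq> u" "v \<noteq> w" "v \<in> V"
      using w neighbors_in_verts[OF v] by auto
    then show "v \<in> N u" using V_eq by blast
  qed
  \<comment> \<open>Every vertex of \<open>N u\<close> is matched, so \<open>w\<close> has at most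
    one neighbour. If \<open>w\<close> is isolated, any \<open>a\<close> will do, and both cases
    share the same weights.\<close>
  obtain a where a: "a \<in> N u" "N w \<subseteq> {a}"
  proof (cases "N w = {}")
    case True
    have "N u \<noteq> {}" using d n by auto
    then show ?thesis using that True by blast
  next
    case False
    then obtain a where "a \<in> N w" by blast
    then show ?thesis
      using that[of a] outside_nbr_of_matched[of a u w] u Nw by blast
  qed
  have "a \<in> M u" using a u(2) by blast
  then obtain b where "b \<in> M u" and b: "b \<in> N u" "b \<in> N a" "b \<noteq> a" "N a \<inter> N u = {b}"
    by (rule partner)
  have ab: "N b \<inter> N u = {a}"
    using partner_unique[of b u a] b(1,2) a(1) neighbors_sym[of a b] by blast
  \<comment> \<open>The remaining n - 4 neighbours share an excess of 1/2, enough to make their rows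
    strict. With 17/10 and 38/100 the row of \<open>u\<close> is strict for n > 5.9 and that of
    \<open>a\<close> for n > 4.18 / 0.7, so both hold from n = 6 on.\<close>
  define y :: "'a \<Rightarrow> real" where "y v = (if v = u then real n - 3 else if v = a \<or> v = b then 17 / 10
    else if v = w then 38 / 100 else 1 + 1 / (2 * (real n - 4)))" for v
  have y_simps: "y u = real n - 3" "y a = 17 / 10" "y b = 17 / 10" "y w = 38 / 100"
    "\<And>v. v \<in> N u - {a, b} \<Longrightarrow> y v = 1 + 1 / (2 * (real n - 4))"
    using w a(1) b(1) by (auto simp: y_def)
  have n': "6 \<le> real n" using n by simp
  have y_pos: "0 < y v" for v
    using n' by (simp add: y_def add_pos_pos)
  \<comment> \<open>Enlarging the neighbour set only increases a row, so the row of \<open>a\<close>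
    can be bounded without deciding whether \<open>w\<close> is adjacent to
    \<open>a\<close>.\<close>
  have bound: "card (N v) * y v + (\<Sum>x\<in>N v. y x) \<le> card B * y v + (\<Sum>x\<in>B. y x)"
    if "N v \<subseteq> B" "finite B" for v B
    using that y_pos card_mono[of B "N v"] by (intro add_mono mult_right_mono sum_mono2) (auto simp: less_imp_le)
  have N_nbr: "N v \<subseteq> insert u (insert w (N v \<inter> N u))" if "v \<in> N u" for v
    using nbr_split[OF that] u(3) by blast
  have row: "card (N v) * y v + (\<Sum>x\<in>N v. y x) < n * y v" if "v \<in> V" for v
  proof -
    have "v \<in> insert u (insert w (N u))"
      using that V_eq by simp
    then consider "v = u" | "v = w" | "v = a" | "v = b" | "v \<in> N u - {a, b}"
      by blast
    then show ?thesis
    proof cases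
      case 1
      have "card (N u - {a, b}) = card (N u) - card {a, b}"
        using a b by (intro card_Diff_subset) auto
      then have c: "card (N u - {a, b}) = n - 4"
        using d b(3) by simp
      have "(\<Sum>x\<in>N u. y x) = (\<Sum>x\<in>N u - {a, b}. y x) + (\<Sum>x\<in>{a, b}. y x)"
        using a b by (intro sum.subset_diff) auto
      also have "(\<Sum>x\<in>N u - {a, b}. y x) = (\<Sum>x\<in>N u - {a, b}. 1 + 1 / (2 * (real n - 4)))"
        by (intro sum.cong refl y_simps)
      also have "\<dots> = (real n - 4) * (1 + 1 / (2 * (real n - 4)))"
        using c n by (simp add: of_nat_diff)
      also have "\<dots> = real n - 4 + 1 / 2"
        using n' by (simp add: field_simps)
      also have "(\<Sum>x\<in>{a, b}. y x) = 34 / 10"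
        using b(3) y_simps by simp
      finally have "(\<Sum>x\<in>N u. y x) = real n - 1 / 10"
        by simp
      then have "card (N u) * y u + (\<Sum>x\<in>N u. y x) = (real n - 2) * (real n - 3) + (real n - 1 / 10)"
        using d n y_simps by (simp add: of_nat_diff)
      also have "\<dots> < n * (real n - 3)"
        using n' by (simp add: algebra_simps)
      finally show ?thesis
        using 1 y_simps by simp
    next
      case 2
      have "card (N w) * y w + (\<Sum>x\<in>N w. y x) \<le> card {a} * y w + (\<Sum>x\<in>{a}. y x)"
        by (rule bound) (simp_all add: a(2))
      also have "\<dots> = 38 / 100 + 17 / 10"
        by (simp add: y_simps)
      also have "\<dots> < n * (38 / 100)"
        using n' by simp
      finally show ?thesis
        using 2 by (simp only: y_simps)
    next
      case 3
      have "N a \<subseteq> {u, w, b}"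
        using N_nbr[OF a(1)] b(4) by blast
      moreover have "u \<noteq> b" "w \<noteq> b"
        using b(1) w(2) neighbors_irrefl by metis+
      ultimately have "card (N a) * y a + (\<Sum>x\<in>N a. y x) \<le> 3 * (17 / 10) + (real n - 3 + (38 / 100 + 17 / 10))"
        using bound[of "a" "{u, w, b}"] w(1) by (simp add: y_simps)
      also have "\<dots> < n * (17 / 10)"
        using n' by simp
      finally show ?thesis
        using 3 by (simp only: y_simps)
    next
      case 4
      have "w \<notin> N b"
        using a(2) b(3) neighbors_sym[of w b] by blast
      then have "N b \<subseteq> {u, a}"
        using N_nbr[OF b(1)] ab by blast
      moreover have "u \<noteq> a"
        using a by auto
      ultimately have "card (N b) * y b + (\<Sum>x\<in>N b. y x) \<le> 2 * (17 / 10) + (real n - 3 + 17 / 10)"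
        using bound[of b "{u, a}"] by (simp add: y_simps)
      also have "\<dots> < n * (17 / 10)"
        using n' by simp
      finally show ?thesis
        using 4 by (simp only: y_simps)
    next
      case 5
      then have "v \<in> M u"
        using u(2) by blast
      then obtain p where "p \<in> M u" and p: "p \<in> N u" "p \<in> N v" and "p \<noteq> v" and Nvp: "N v \<inter> N u = {p}"
        by (rule partner)
      have "v \<in> N p"
        using p(2) neighbors_sym[of p v] by blast
      then have "p \<noteq> a" "p \<noteq> b"
        using 5 b(4) ab by blast+
      then have yp: "y p = 1 + 1 / (2 * (real n - 4))"
        using p by (intro y_simps) auto
      have "w \<notin> N v"
        using a(2) 5 neighbors_sym[of w v] by blast
      then have "N v \<subseteq> {u, p}"
        using N_nbr[of v] 5 Nvp by blast
      moreover have "u \<noteq> p"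
        using p by auto
      moreover have yv: "y v = 1 + 1 / (2 * (real n - 4))"
        using 5 by (intro y_simps)
      ultimately have "card (N v) * y v + (\<Sum>x\<in>N v. y x) \<le> 3 * (1 + 1 / (2 * (real n - 4))) + (real n - 3)"
        using bound[of v "{u, p}"] by (simp add: yp y_simps(1))
      also have "\<dots> < n * (1 + 1 / (2 * (real n - 4)))"
      proof -
        have "(real n - 3) * 1 < (real n - 3) * (1 + 1 / (2 * (real n - 4)))"
          using n' by (intro mult_strict_left_mono) auto
        then show ?thesis
          by (simp add: left_diff_distrib)
      qed
      finally show ?thesis
        by (simp only: yv)
    qed
  qed
  have "V \<noteq> {}" using u by blast
  then show ?thesis
    using y_pos row by (rule signless_radius_less_weighted_rows)
qed

section \<open>The exceptional configuration in orders 4 and 5\<close>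

text \<open>\<open>u\<close> and its two matched neighbours form a triangle; an edge from
  \<open>w\<close> to \<open>a\<close> or \<open>b\<close> would make that vertex dominating, so
  \<open>w\<close> is isolated.\<close>

lemma exceptional_order_4:
  assumes V4: "card V = 4" and u: "u \<in> V" "M u = N u" "W u = {w}" and W: "\<And>v. v \<in> V \<Longrightarrow> W v \<noteq> {}"
  shows "digraph_iso (with_proj G) (with_proj triangle_plus_vertex)" "signless_radius G \<le> 4"
proof -
  have "card (N u) = 2"
    using card_verts_split[OF u(1)] V4 u(3) by simp
  then obtain a where a: "a \<in> N u"
    by (metis card.empty ex_in_conv zero_neq_numeral)
  have "a \<in> M u" using a u(2) by blast
  then obtain b where "b \<in> M u" and b: "b \<in> N u" "b \<in> N a" "b \<noteq> a" "N a \<inter> N u = {b}"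
    by (rule partner)
  have Nu: "N u = {a, b}"
    using \<open>card (N u) = 2\<close> a b(1,3) card_subset_eq[of "N u" "{a, b}"] by simp
  have w: "w \<noteq> u" "w \<noteq> a" "w \<noteq> b" "u \<noteq> a" "u \<noteq> b"
  proof -
    have "w \<in> W u" using u(3) by simp
    then have "w \<noteq> u" "w \<notin> N u" "u \<notin> N u"
      by (auto simp: W_def)
    then show "w \<noteq> u" "w \<noteq> a" "w \<noteq> b" "u \<noteq> a" "u \<noteq> b"
      unfolding Nu by auto
  qed
  have V_eq: "V = {u, a, b, w}"
    using u neighbors_subset[of u] Nu by (auto simp: W_def)
  have full: "w \<notin> N x" if "x \<in> {a, b}" for x
  proof
    assume "w \<in> N x"
    then have "W x = {}"
      using that V_eq a b neighbors_sym[of a u] neighbors_sym[of b u] neighbors_sym[of a b] by (auto simp: W_def)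
    then show False
      using W that V_eq by blast
  qed
  have "w \<notin> N u"
    using u(3) by (auto simp: W_def)
  have ab: "N b \<inter> N u = {a}"
    using partner_unique[of b u a] b(1,2) a neighbors_sym[of a b] by blast
  have Na: "N a = {u, b}"
    by (subst nbr_split[OF a]) (use full in \<open>simp add: b(4) u(3)\<close>)
  have Nb: "N b = {u, a}"
    by (subst nbr_split[OF b(1)]) (use full in \<open>simp add: ab u(3)\<close>)
  have Nw: "N w = {}"
  proof (rule equals0I)
    fix x assume x: "x \<in> N w"
    then have "x \<in> {u, a, b, w}"
      using neighbors_in_verts(2)[OF x] V_eq by simp
    moreover have "w \<in> N x"
      using x neighbors_sym[of x w] by simp
    ultimately show False
      using full \<open>w \<notin> N u\<close> by auto
  qed
  have arcs: "parcs G = {(u, a), (a, u), (u, b), (b, u), (a, b), (b, a)}"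
  proof -
    have *: "(x, z) \<in> parcs G \<longleftrightarrow> (x, z) \<in> {(u, a), (a, u), (u, b), (b, u), (a, b), (b, a)}" for x z
    proof (cases "x \<in> V")
      case True
      then consider "x = u" | "x = a" | "x = b" | "x = w"
        unfolding V_eq by blast
      then show ?thesis
        by cases (auto simp: in_neighbors[symmetric] Na Nb Nw Nu w b(3))
    next
      case False
      then have "(x, z) \<notin> parcs G"
        using in_arcsD1 by blast
      moreover have "x \<notin> {u, a, b, w}"
        using False unfolding V_eq .
      ultimately show ?thesis
        by auto
    qed
    show ?thesis
    proof (rule Set.set_eqI)
      fix e
      show "e \<in> parcs G \<longleftrightarrow> e \<in> {(u, a), (a, u), (u, b), (b, u), (a, b), (b, a)}"
        by (cases e) (simp only: *)
    qed
  qed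
  define h :: "'a \<Rightarrow> nat" where "h x = (if x = u then 0 else if x = a then 1 else if x = b then 2 else 3)" for x
  have h: "h u = 0" "h a = 1" "h b = 2" "h w = 3"
    using w b(3) by (auto simp: h_def)
  have parcs_T: "parcs triangle_plus_vertex = {(0, 1), (1, 0), (0, 2), (2, 0), (1, 2), (2, 1)}"
    by (auto simp: triangle_plus_vertex_def)
  show "digraph_iso (with_proj G) (with_proj triangle_plus_vertex)"
  proof (rule digraph_iso_pairI)
    show "pair_wf_digraph G" by unfold_locales
    show "inj_on h V"
      unfolding V_eq inj_on_def by (simp add: h)
    show "pverts triangle_plus_vertex = h ` V"
      unfolding V_eq by (simp add: h)
    show "parcs triangle_plus_vertex = (\<lambda>(u, v). (h u, h v)) ` parcs G"
      unfolding arcs parcs_T by (simp add: h)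
  qed
  show "signless_radius G \<le> 4"
  proof (rule ccontr)
    assume "\<not> ?thesis"
    \<comment> \<open>With constant weights the rows are 4 on the triangle and 0 at
      \<open>w\<close>, so a radius above 4 would be strictly below itself.\<close>
    then have "card (N v) * 1 + (\<Sum>x\<in>N v. 1) < signless_radius G * 1" if "v \<in> V" for v
      using that w b(3) unfolding V_eq by (auto simp: Na Nb Nw Nu)
    then have "signless_radius G < signless_radius G"
      using u(1) by (intro signless_radius_less_weighted_rows[of "\<lambda>_. 1"]) auto
    then show False by simp
  qed
qed

text \<open>Parity: \<open>N u\<close> would consist of three vertices matched in pairs.\<close>

lemma no_exceptional_order_5:
  assumes "card V = 5" and u: "u \<in> V" "M u = N u" "W u = {w}"
  shows False
proof -
  have d: "card (N u) = 3"
    using card_verts_split[OF u(1)] assms(1) u(3) by simp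
  then obtain a where a: "a \<in> M u"
    using u(2) by (metis card.empty ex_in_conv zero_neq_numeral)
  then obtain b where "b \<in> M u" and b: "b \<in> N u" "b \<in> N a" "b \<noteq> a" "N a \<inter> N u = {b}"
    by (rule partner)
  have ab: "N b \<inter> N u = {a}"
    using partner_unique[of b u a] b(1,2) a M_subset[of u] neighbors_sym[of a b] by blast
  have "card (N u - {a, b}) = card (N u) - card {a, b}"
    using a b u(2) by (intro card_Diff_subset) auto
  then have "card (N u - {a, b}) = 1"
    using d b(3) by simp
  then obtain c where c: "N u - {a, b} = {c}"
    by (rule card_1_singletonE)
  then have "c \<in> M u" using u(2) by blast
  then obtain e where e: "e \<in> N u" "e \<in> N c" "e \<noteq> c"
    using partner by metis
  then have "e = a \<or> e = b" using c by blast
  then show False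
    using e(2) b(4) ab c neighbors_sym[of c a] neighbors_sym[of c b] by blast
qed

text \<open>The excluded configuration of \<open>signless_radius_ge_order\<close> is treated by
  order: too small a radius from 6 on, impossible for 5, a triangle with an isolated vertex for 4.
  The exact value of the radius is recorded for part (ii).\<close>

lemma signless_radius_no_dominating:
  assumes n: "card V = n" "4 \<le> n" and W: "\<And>u. u \<in> V \<Longrightarrow> W u \<noteq> {}"
    and q: "real n \<le> signless_radius G"
  shows "signless_radius G = n \<and>
    (complete_bipartite_digraph 2 (n - 2) (with_proj G) \<or>
      digraph_iso (with_proj G) (with_proj triangle_plus_vertex))"
proof (cases "\<exists>u\<in>V. N u \<noteq> {} \<and> M u = N u \<and> card (W u) = 1")
  case True
  then obtain u w where u: "u \<in> V" "M u = N u" "W u = {w}"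
    by (metis card_1_singletonE)
  have "n = 4"
    using signless_radius_lt_order[OF n(1) _ u] no_exceptional_order_5[OF _ u] n q by fastforce
  then show ?thesis
    using exceptional_order_4[OF _ u W] n q by force
next
  case False
  obtain u where u: "u \<in> V" "N u \<noteq> {}" "M u = {}" "\<And>w. w \<in> W u \<Longrightarrow> N u \<subseteq> N w"
      and q_eq: "signless_radius G = n"
    using signless_radius_ge_order[OF n W _ q] False by blast
  have "complete_bipartite_digraph 2 (card V - 2) (with_proj G)"
    by (rule complete_bipartite_2_if_join[OF u(1,3,4) W[OF u(1)] u(2) W])
      (use neighbors_subset[of u] in blast)+
  then show ?thesis
    using q_eq n by simp
qed

section \<open>Graphs with a dominating vertex\<close>

text \<open>Swapping partners is an involution on \<open>M u\<close> without fixed points, so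
  \<open>involution_enumeration\<close> numbers the matched leaves in pairs; the other leaves
  follow. The size of \<open>M u\<close> is kept because part (ii) needs it.\<close>

lemma dominating_vertex_iso:
  assumes u: "u \<in> V" "W u = {}"
  obtains c where "card (M u) = 2 * c" "2 * c \<le> card V - 1"
    "digraph_iso (with_proj G) (with_proj (star_plus_matching (card V) c))"
proof -
  define n where "n = card V"
  have card_N: "card (N u) = n - 1"
    using card_verts_split[OF u(1)] u(2) by (simp add: n_def)
  have n: "0 < n"
    using u(1) pair_finite_verts by (auto simp: n_def card_gt_0_iff)
  define p where "p a = (THE b. N a \<inter> N u = {b})" for a
  have p: "N a \<inter> N u = {p a}" "p a \<in> M u" "p a \<noteq> a" if "a \<in> M u" for a
  proof -
    obtain b where b: "b \<in> M u" "b \<in> N u" "b \<in> N a" "b \<noteq> a" "N a \<inter> N u = {b}"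
      using \<open>a \<in> M u\<close> by (rule partner)
    then have "p a = b"
      by (simp add: p_def)
    with b show "N a \<inter> N u = {p a}" "p a \<in> M u" "p a \<noteq> a" by simp_all
  qed
  have pp: "p (p a) = a" if a: "a \<in> M u" for a
  proof -
    have "a \<in> N (p a) \<inter> N u"
      using p(1)[OF a] neighbors_sym[of a "p a"] a M_subset by blast
    then show ?thesis
      using p(1)[OF p(2)[OF a]] by simp
  qed
  obtain c and g :: "nat \<Rightarrow> 'a" where g: "bij_betw g {1..2 * c} (M u)"
    and pg: "\<And>j. j \<in> {1..c} \<Longrightarrow> p (g (2 * j - 1)) = g (2 * j)"
    by (rule involution_enumeration[of "M u" p]) (use p(2,3) pp in auto)
  have card_M: "card (M u) = 2 * c"
    using bij_betw_same_card[OF g] by simp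
  have c: "2 * c \<le> n - 1"
    using card_M_le[of u] card_M card_N by simp
  have "card {2 * c + 1..<n} = card (N u - M u)"
    using card_N card_M M_subset by (simp add: card_Diff_subset)
  then obtain k where k: "bij_betw k {2 * c + 1..<n} (N u - M u)"
    using finite_same_card_bij[of "{2 * c + 1..<n}" "N u - M u"] by auto
  define e where "e i = (if i = 0 then u else if i \<le> 2 * c then g i else k i)" for i
  have "bij_betw e {1..2 * c} (M u)"
    using g by (subst bij_betw_cong[of _ _ g]) (auto simp: e_def)
  moreover have "bij_betw e {2 * c + 1..<n} (N u - M u)"
    using k by (subst bij_betw_cong[of _ _ k]) (auto simp: e_def)
  ultimately have "bij_betw e ({1..2 * c} \<union> {2 * c + 1..<n}) (M u \<union> (N u - M u))"
    by (rule bij_betw_combine) auto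
  moreover have "{1..2 * c} \<union> {2 * c + 1..<n} = {1..<n}"
    using c n by auto
  moreover have "M u \<union> (N u - M u) = N u"
    using M_subset by blast
  ultimately have e1: "bij_betw e {1..<n} (N u)"
    by simp
  have "bij_betw e ({1..<n} \<union> {0}) (N u \<union> {u})"
    by (rule bij_betw_combine[OF e1]) (auto simp: e_def bij_betw_def)
  moreover have "{1..<n} \<union> {0} = {0..<n}"
    using n by auto
  moreover have "N u \<union> {u} = V"
    using u neighbors_subset[of u] by (auto simp: W_def)
  ultimately have e: "bij_betw e {0..<n} V"
    by simp
  define r where "r = {0} \<times> {1..<n} \<union> (\<lambda>j. (2 * j - 1, 2 * j)) ` {1..c}"
  define f where "f = (\<lambda>(i, j). (e i, e j))"
  define E where "E = {u} \<times> N u \<union> (\<lambda>j. (g (2 * j - 1), g (2 * j))) ` {1..c}"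
  have "f ` ({0} \<times> {1..<n}) = {u} \<times> e ` {1..<n}"
    unfolding f_def image_paired_Times by (simp add: e_def)
  moreover have "f ` (\<lambda>j. (2 * j - 1, 2 * j)) ` {1..c} = (\<lambda>j. (g (2 * j - 1), g (2 * j))) ` {1..c}"
    unfolding image_image by (intro image_cong refl) (auto simp: f_def e_def)
  ultimately have "f ` r = E"
    using e1 by (simp add: r_def E_def image_Un bij_betw_def)
  moreover have "f ` (r\<inverse>) = (f ` r)\<inverse>"
    by (auto simp: f_def)
  ultimately have image: "f ` (r \<union> r\<inverse>) = E \<union> E\<inverse>"
    by (simp add: image_Un)
  have arc_iff: "(x, z) \<in> parcs G \<longleftrightarrow> (z, x) \<in> parcs G" for x z
    using neighbors_sym[of z x] by (simp add: in_neighbors)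
  have "(x, z) \<in> parcs G" if xz: "(x, z) \<in> E" for x z
  proof -
    consider "x = u" "z \<in> N u" | j where "j \<in> {1..c}" "x = g (2 * j - 1)" "z = g (2 * j)"
      using xz by (auto simp: E_def)
    then show ?thesis
    proof cases
      case 1
      then show ?thesis by (simp add: in_neighbors)
    next
      case 2
      then have "2 * j - 1 \<in> {1..2 * c}" by auto
      then have "x \<in> M u"
        using bij_betwE[OF g] 2(2) by blast
      then show ?thesis
        using p(1)[of x] pg[of j] 2 by (auto simp: in_neighbors)
    qed
  qed
  then have "E \<union> E\<inverse> \<subseteq> parcs G"
    using arc_iff by auto
  moreover have "(x, z) \<in> E \<union> E\<inverse>" if xz: "(x, z) \<in> parcs G" for x z
  proof (cases "x = u \<or> z = u")
    case True
    then show ?thesis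
      using xz arc_iff by (auto simp: E_def in_neighbors)
  next
    case False
    have "z \<in> N x"
      using xz by (simp add: in_neighbors)
    have "x \<in> V" "z \<in> V"
      using xz by (auto dest: in_arcsD1 in_arcsD2)
    then have "x \<in> N u" "z \<in> N u"
      using False u(2) by (auto simp: W_def)
    then have "x \<in> M u" "z = p x"
      using p(1)[of x] \<open>z \<in> N x\<close> by (auto simp: M_def)
    obtain i where i: "i \<in> {1..2 * c}" "x = g i"
      using bij_betw_imp_surj_on[OF g] \<open>x \<in> M u\<close> by blast
    show ?thesis
    \<comment> \<open>\<open>pg\<close> maps the odd index of a pair to the even one; at an even
      index it is inverted by \<open>pp\<close>.\<close>
    proof (cases "even i")
      case True
      then obtain j where j: "i = 2 * j" by blast
      then have j': "j \<in> {1..c}" using i by auto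
      then have "2 * j - 1 \<in> {1..2 * c}" by auto
      then have "g (2 * j - 1) \<in> M u"
        using bij_betwE[OF g] by blast
      then have "z = g (2 * j - 1)"
        using pp pg[OF j'] i(2) j \<open>z = p x\<close> by metis
      then show ?thesis
        using i j j' by (auto simp: E_def)
    next
      case False
      then obtain j where j: "i = 2 * j + 1" by (rule oddE)
      then have j': "Suc j \<in> {1..c}" "i = 2 * Suc j - 1" using i by auto
      then have "z = g (2 * Suc j)"
        using pg[OF j'(1)] i(2) \<open>z = p x\<close> by simp
      then show ?thesis
        using i(2) j' unfolding E_def by blast
    qed
  qed
  then have "parcs G \<subseteq> E \<union> E\<inverse>"
    by (rule subrelI)
  ultimately have arcs: "parcs G = E \<union> E\<inverse>"
    by (rule equalityI[rotated])
  have star: "pverts (star_plus_matching n c) = {0..<n}" "parcs (star_plus_matching n c) = r \<union> r\<inverse>"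
    by (simp_all add: star_plus_matching_def Let_def r_def)
  \<comment> \<open>\<open>e\<close> maps numbers to vertices, so the isomorphism is built from the
    star to \<open>G\<close> and reversed afterwards.\<close>
  have "digraph_iso (with_proj (star_plus_matching n c)) (with_proj G)"
  proof (rule digraph_iso_pairI)
    show "pair_wf_digraph (star_plus_matching n c)"
      using c by (rule pair_wf_digraph_star_plus_matching)
    show "inj_on e (pverts (star_plus_matching n c))" "V = e ` pverts (star_plus_matching n c)"
      using e by (simp_all add: star bij_betw_def)
    show "parcs G = (\<lambda>(i, j). (e i, e j)) ` parcs (star_plus_matching n c)"
      by (simp only: arcs star image flip: f_def)
  qed
  moreover have "wf_digraph (with_proj (star_plus_matching n c))"
  proof -
    interpret star: pair_wf_digraph "star_plus_matching n c"
      using c by (rule pair_wf_digraph_star_plus_matching)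
    show ?thesis by (rule star.wf_digraph)
  qed
  ultimately have "digraph_iso (with_proj G) (with_proj (star_plus_matching n c))"
    by (rule digraph_iso_swap[rotated])
  then show ?thesis
    using that card_M c by (simp add: n_def)
qed

text \<open>
  Weights \<open>T - 3\<close> at the centre, \<open>1\<close> at matched leaves and \<open>(T - 3) / (T - 1)\<close> at the others give
  equality with \<open>T\<close> in every row but the central one.
\<close>

lemma dominating_vertex_signless_radius_less:
  assumes u: "u \<in> V" "W u = {}" and T: "3 < T"
    and center: "real (card (M u)) + (real (card V) - 1 - card (M u)) * ((T - 3) / (T - 1))
      < (T - card V + 1) * (T - 3)"
  shows "signless_radius G < T"
proof (rule ccontr)
  assume "\<not> signless_radius G < T"
  then have q: "T \<le> signless_radius G" by simp
  define s where "s = (T - 3) / (T - 1)"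
  \<comment> \<open>The second equation is the row of an unmatched leaf, which has degree 1 and sees
    only the centre.\<close>
  have s: "0 < s" "s + (T - 3) = T * s"
    using T by (auto simp: s_def field_simps)
  define y where "y v = (if v = u then T - 3 else if v \<in> M u then 1 else s)" for v
  have y_pos: "0 < y v" for v
    using T s by (simp add: y_def)
  have card_N: "card (N u) = card V - 1" and V: "1 \<le> card V"
    using card_verts_split[OF u(1)] u(2) by simp_all
  have "u \<notin> M u"
    using M_subset neighbors_irrefl by blast
  have row_u: "card (N u) * y u + (\<Sum>v\<in>N u. y v) < T * y u"
  proof -
    have "(\<Sum>v\<in>N u. y v) = (\<Sum>v\<in>N u. if v \<in> M u then 1 else s)"
      using neighbors_irrefl by (intro sum.cong refl) (auto simp: y_def)
    also have "\<dots> = card (M u) + real (card (N u - M u)) * s"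
      using M_subset[of u] by (simp add: sum.If_cases Int_absorb1 Diff_eq)
    also have "real (card (N u - M u)) = real (card V) - 1 - card (M u)"
      using card_N V card_M_le[of u] M_subset[of u] by (simp add: card_Diff_subset of_nat_diff)
    finally have "card (N u) * y u + (\<Sum>v\<in>N u. y v)
        = (real (card V) - 1) * (T - 3) + (card (M u) + (real (card V) - 1 - card (M u)) * s)"
      using card_N V by (simp add: y_def of_nat_diff)
    also have "\<dots> < (real (card V) - 1) * (T - 3) + (T - card V + 1) * (T - 3)"
      using center by (simp add: s_def)
    also have "\<dots> = T * y u"
      by (simp add: y_def algebra_simps)
    finally show ?thesis .
  qed
  have row: "card (N v) * y v + (\<Sum>x\<in>N v. y x) \<le> T * y v" if "v \<in> V" for v
  proof (cases "v = u")
    case True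
    then show ?thesis using row_u by simp
  next
    case False
    then have v: "v \<in> N u"
      using that u(2) by (auto simp: W_def)
    show ?thesis
    proof (cases "v \<in> M u")
      case True
      then obtain b where b: "b \<in> M u" "b \<in> N u" "b \<in> N v" "b \<noteq> v" "N v \<inter> N u = {b}"
        by (rule partner)
      have "N v = {u, b}"
        by (subst nbr_split[OF v]) (simp add: b(5) u(2))
      moreover have "u \<noteq> b"
        using b(1) \<open>u \<notin> M u\<close> by blast
      ultimately show ?thesis
        using True False b(1) by (simp add: y_def)
    next
      case nM: False
      then have "N v \<inter> N u = {}"
        using v by (simp add: M_def)
      then have "N v = {u}"
        by (subst nbr_split[OF v]) (simp add: u(2))
      then show ?thesis
        using nM False s by (simp add: y_def)
    qed
  qed
  have "V \<noteq> {}" using u by blast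
  show False
  proof (rule signless_radius_weighted_rows[OF \<open>V \<noteq> {}\<close> y_pos row q])
    fix S assume S: "S \<noteq> {}" "S \<subseteq> V" "\<And>v. v \<in> S \<Longrightarrow> N v \<subseteq> S"
      and S_rows: "\<And>v. v \<in> S \<Longrightarrow> card (N v) * y v + (\<Sum>x\<in>N v. y x) = T * y v"
    obtain v where v: "v \<in> S" using S(1) by blast
    \<comment> \<open>A nonempty set closed under adjacency contains the dominating vertex, so
      strictness in the central row alone is enough.\<close>
    have "u \<in> S"
    proof (cases "v = u")
      case False
      then have "v \<in> N u"
        using v S(2) u(2) by (auto simp: W_def)
      then show ?thesis
        using S(3)[OF v] neighbors_sym[of v u] by blast
    qed (use v in simp)
    then show False
      using S_rows[of u] row_u by simp
  qed
qed

end

section \<open>The threshold of part (ii)\<close>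

text \<open>The larger root of T^2 - (n + 2)T + 2(n - 1) for odd n, and of T^2 - (n + 1)T + (n - 2)
  for even n.\<close>

definition friendship_radius :: "nat \<Rightarrow> real" where
  "friendship_radius n = (if odd n then (real n + 2 + sqrt ((real n - 2)\<^sup>2 + 8)) / 2
     else (real n + 1 + sqrt ((real n - 1)\<^sup>2 + 8)) / 2)"

lemma friendship_radius_gt:
  assumes "4 \<le> n"
  shows "real n < friendship_radius n"
proof -
  have "real n - 2 < sqrt ((real n - 2)\<^sup>2 + 8)" "real n - 1 < sqrt ((real n - 1)\<^sup>2 + 8)"
    by (rule real_less_rsqrt, simp)+
  then show ?thesis
    by (simp add: friendship_radius_def)
qed

text \<open>At the threshold the central row for the weights of
  \<open>dominating_vertex_signless_radius_less\<close> is an equality when the matching is as large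
  as possible: it misses no leaf for odd n and one leaf for even n.\<close>

lemma friendship_radius_center:
  assumes "4 \<le> n" and T: "T = friendship_radius n" and m: "m = 2 * ((n - 1) div 2)"
  shows "(T - n + 1) * (T - 3) = real m + (real n - 1 - m) * ((T - 3) / (T - 1))"
proof (cases "odd n")
  case True
  define r where "r = sqrt ((real n - 2)\<^sup>2 + 8)"
  have r: "r * r = (real n - 2)\<^sup>2 + 8"
    by (simp add: r_def flip: power2_eq_square)
  have T_eq: "T = (real n + 2 + r) / 2"
    using T True by (simp add: friendship_radius_def r_def)
  have "real m = real n - 1"
    using True m assms(1) by (simp add: of_nat_diff)
  moreover have "(T - n + 1) * (T - 3) = (r * r - (real n - 4)\<^sup>2) / 4"
    unfolding T_eq by (simp add: field_simps power2_eq_square)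
  ultimately show ?thesis
    unfolding r by (simp add: field_simps power2_eq_square)
next
  case False
  define r where "r = sqrt ((real n - 1)\<^sup>2 + 8)"
  have r: "r * r = (real n - 1)\<^sup>2 + 8"
    by (simp add: r_def flip: power2_eq_square)
  have T_eq: "T = (real n + 1 + r) / 2"
    using T False by (simp add: friendship_radius_def r_def)
  have "T * T - (n + 1) * T + (real n - 2) = (r * r - (real n + 1)\<^sup>2) / 4 + (real n - 2)"
    unfolding T_eq by (simp add: field_simps power2_eq_square)
  also have "\<dots> = 0"
    unfolding r by (simp add: field_simps power2_eq_square)
  finally have quad: "T * T - (n + 1) * T + (real n - 2) = 0" .
  \<comment> \<open>Clearing the denominator \<open>T - 1\<close> gives a cubic, which splits into
    \<open>T - 2\<close> and the quadratic defining the threshold.\<close>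
  have "(T - n + 1) * (T - 3) * (T - 1) - ((real n - 2) * (T - 1) + (T - 3))
      = (T - 2) * (T * T - (n + 1) * T + (real n - 2))"
    by (simp add: algebra_simps)
  then have "(T - n + 1) * (T - 3) * (T - 1) = (real n - 2) * (T - 1) + (T - 3)"
    unfolding quad by simp
  moreover have "1 < T"
    using friendship_radius_gt[OF assms(1)] assms(1) T by linarith
  moreover have "real m = real n - 2"
  proof -
    obtain l where "n = 2 * l" using False by blast
    then have "m = n - 2" using m assms(1) by (cases l) auto
    then show ?thesis using assms(1) by (simp add: of_nat_diff)
  qed
  ultimately show ?thesis
    by (simp add: field_simps)
qed

text \<open>An unmatched leaf has weight s < 1 against 1 for a matched one, so a smaller matching
  lowers the central sum and makes the central row strict.\<close>

lemma (in chorded_cycle_free) dominating_vertex_signless_radius_less_friendship: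
  assumes u: "u \<in> V" "W u = {}" and n: "card V = n" "4 \<le> n"
    and "card (M u) = 2 * c" "c < (n - 1) div 2"
  shows "signless_radius G < friendship_radius n"
proof (rule dominating_vertex_signless_radius_less[OF u])
  define T where "T = friendship_radius n"
  define s where "s = (T - 3) / (T - 1)"
  define m where "m = 2 * ((n - 1) div 2)"
  show T3: "3 < friendship_radius n"
    using friendship_radius_gt[OF n(2)] n(2) by linarith
  then have "s < 1"
    by (simp add: s_def T_def)
  moreover have "real (card (M u)) < real m"
    using assms(5,6) by (simp add: m_def)
  ultimately have "(real m - card (M u)) * s < (real m - card (M u)) * 1"
    by (intro mult_strict_left_mono) auto
  then have "real (card (M u)) + (real n - 1 - card (M u)) * s < real m + (real n - 1 - m) * s"
    by (simp add: algebra_simps)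
  also have "\<dots> = (T - n + 1) * (T - 3)"
    using friendship_radius_center[OF n(2) T_def m_def] by (simp add: s_def)
  finally show "real (card (M u)) + (real (card V) - 1 - card (M u)) * ((friendship_radius n - 3) / (friendship_radius n - 1))
      < (friendship_radius n - card V + 1) * (friendship_radius n - 3)"
    by (simp add: n(1) T_def s_def)
qed

theorem theorem1p1:
  fixes G :: "'a pair_pre_digraph" and n :: nat
  assumes "pair_graph G" and "card (pverts G) = n" and "n \<ge> 4"
  shows "(signless_radius G \<ge> real n \<longrightarrow>
            contains_chorded_cycle G \<or>
            complete_bipartite_digraph 2 (n - 2) (with_proj G) \<or>
            (\<exists>c \<in> {0..(n - 1) div 2}.
               digraph_iso (with_proj G) (with_proj (star_plus_matching n c))) \<or>
            digraph_iso (with_proj G) (with_proj triangle_plus_vertex))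
       \<and> (signless_radius G \<ge>
            (if odd n then (real n + 2 + sqrt ((real n - 2)\<^sup>2 + 8)) / 2
             else (real n + 1 + sqrt ((real n - 1)\<^sup>2 + 8)) / 2) \<longrightarrow>
            contains_chorded_cycle G \<or>
            digraph_iso (with_proj G) (with_proj (friendship_graph n)))"
proof (cases "contains_chorded_cycle G")
  case False
  interpret chorded_cycle_free G
    using assms(1) False by (simp add: chorded_cycle_free_def chorded_cycle_free_axioms_def)
  show ?thesis
  proof (cases "\<exists>u\<in>V. W u = {}")
    case True
    then obtain u where u: "u \<in> V" "W u = {}" by blast
    then obtain c where c: "card (M u) = 2 * c" "2 * c \<le> n - 1"
        and iso: "digraph_iso (with_proj G) (with_proj (star_plus_matching n c))"
      using dominating_vertex_iso[of u] assms(2) by metis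
    have "c \<le> (n - 1) div 2"
      using c(2) by simp
    moreover have "digraph_iso (with_proj G) (with_proj (friendship_graph n))"
      if "friendship_radius n \<le> signless_radius G"
    proof -
      have "\<not> c < (n - 1) div 2"
        using dominating_vertex_signless_radius_less_friendship[OF u assms(2,3) c(1)] that by auto
      then show ?thesis
        using iso \<open>c \<le> (n - 1) div 2\<close> by (simp add: friendship_graph_def)
    qed
    ultimately show ?thesis
      using iso unfolding friendship_radius_def by auto
  next
    case False
    then have "signless_radius G = n \<and>
        (complete_bipartite_digraph 2 (n - 2) (with_proj G) \<or>
          digraph_iso (with_proj G) (with_proj triangle_plus_vertex))"
      if "real n \<le> signless_radius G"
      using signless_radius_no_dominating[OF assms(2,3) _ that] by blast
    \<comment> \<open>A radius of at least n equals n here and the threshold exceeds n, so part (ii)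
      is vacuous without a dominating vertex.\<close>
    moreover from this have "signless_radius G < friendship_radius n"
      using friendship_radius_gt[OF assms(3)] by fastforce
    ultimately show ?thesis
      unfolding friendship_radius_def by auto
  qed
qed simp

end
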